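(* Let $F$ be a subfield of $\mathbb{R}$. If $\hat s$ and $\hat t$ are terms in normal form and $T[F]$ proves $\hat s=\hat t$, then $\hat s$ and $\hat t$ are syntactically identical.
   Context: For $a\in F$, $f_a(x)=ax$. $T_{\mathrm{add}}[F]$ is the set of sentences true in $(\mathbb{R},0,1,+,-,<,(f_a)_{a\in F})$, $T_{\mathrm{mult}}[F]$ the set of sentences true in $(\mathbb{R},0,1,\times,\div,<,(f_a)_{a\in F})$ with $x\div0=0$, and $T[F]=T_{\mathrm{add}}[F]\cup T_{\mathrm{mult}}[F]$; an equation with free variables is provable if its universal closure is. We write $at$ for $f_a(t)$. Variables are indexed $x_1,x_2,\ldots$. Preterms and their ranks: rank $0$ (basic) preterms are the variables and the constant $1$. For odd $n>0$, the additive preterms of rank $n$ are $a_1t_1+\cdots+a_kt_k$ (parenthesized to the left) with $k\ge2$, $a_i\in F\setminus\{0\}$, each $t_i$ a multiplicative or basic preterm of rank $\le n-1$, and some $t_i$ of rank $n-1$. For even $n>0$, the multiplicative preterms of rank $n$ are $t_1^{i_1}\cdots t_k^{i_k}$ (left-parenthesized) with each $t_j$ an additive or basic preterm of rank $\le n-1$ other than $1$, the $i_j$ nonzero integers, $k\ge2$ or $i_1\ne1$, and some $t_j$ of rank at least $n-2$; here $t^i$ is the $i$-fold product of $t$ if $i>0$ and $1\div(t^{-i})$ if $i<0$. Normal form and a strict order $\prec$ on normal-form preterms are defined simultaneously by induction on rank. Rank $0$: all basic preterms are in normal form, ordered $1\succ x_1\succ x_2\succ\cdots$. Odd $n$: $a_1t_1+\cdots+a_kt_k$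 is in normal form iff every $t_i$ is, $t_1\succ t_2\succ\cdots\succ t_k$, and $a_1=1$; to compare $s,t$ of rank $\le n$ with at least one of rank $n$, write $s=\sum_i a_iu_i$, $t=\sum_i b_iu_i$ over the common list $u_1\succ\cdots\succ u_k$ of preterms of rank $\le n-1$ (coefficients now allowed to be $0$; a non-additive preterm $u$ is $1\cdot u$), and set $s\prec t$ iff $a_i\ne b_i$ for some $i$ and $a_i<b_i$ for the least such $i$. Even $n$: $t_1^{i_1}\cdots t_k^{i_k}$ is in normal form iff each $t_j$ is and $t_1\succ\cdots\succ t_k$; to compare $s,t$ of rank $\le n$, list the subterms of both, together with $1$, in $\succ$-decreasing order $u_1,\ldots,u_m,1,u_{m+1},\ldots,u_k$ and write $s=u_1^{i_1}\cdots u_m^{i_m}\cdot1\cdot u_{m+1}^{i_{m+1}}\cdots u_k^{i_k}$, $t=u_1^{j_1}\cdots u_m^{j_m}\cdot1\cdot u_{m+1}^{j_{m+1}}\cdots u_k^{j_k}$ (exponents may be $0$); then $s\prec t$ iff either there is $l\le m$ with $i_l\ne j_l$ and $i_l<j_l$ for the least such $l$, or $i_l=j_l$ for all $l\le m$ but there is $l>m$ with $i_l\ne j_l$ and $i_l>j_l$ for the largest such $l$. A term is in normal form if it is $0$ or of the form $at$ with $t$ a preterm in normal form and $a\in F\setminus\{0\}$. *)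

theory Defs
  imports Complex_Main
begin

definition subfield_of_reals :: "real set \<Rightarrow> bool" where
  "subfield_of_reals F \<longleftrightarrow> 0 \<in> F \<and> 1 \<in> F \<and>
     (\<forall>x\<in>F. \<forall>y\<in>F. x + y \<in> F \<and> x - y \<in> F \<and> x * y \<in> F) \<and>
     (\<forall>x\<in>F. x \<noteq> 0 \<longrightarrow> inverse x \<in> F)"

datatype fterm = V nat | Zero | One | Add fterm fterm | Sub fterm fterm
  | Mul fterm fterm | Dv fterm fterm | Sc real fterm

fun add_lang :: "real set \<Rightarrow> fterm \<Rightarrow> bool" where
  "add_lang F (V i) = True"
| "add_lang F Zero = True"
| "add_lang F One = True"
| "add_lang F (Add s t) = (add_lang F s \<and> add_lang F t)"
| "add_lang F (Sub s t) = (add_lang F s \<and> add_lang F t)"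
| "add_lang F (Mul s t) = False"
| "add_lang F (Dv s t) = False"
| "add_lang F (Sc a t) = (a \<in> F \<and> add_lang F t)"

fun mult_lang :: "real set \<Rightarrow> fterm \<Rightarrow> bool" where
  "mult_lang F (V i) = True"
| "mult_lang F Zero = True"
| "mult_lang F One = True"
| "mult_lang F (Add s t) = False"
| "mult_lang F (Sub s t) = False"
| "mult_lang F (Mul s t) = (mult_lang F s \<and> mult_lang F t)"
| "mult_lang F (Dv s t) = (mult_lang F s \<and> mult_lang F t)"
| "mult_lang F (Sc a t) = (a \<in> F \<and> mult_lang F t)"

fun fv_term :: "fterm \<Rightarrow> nat set" where
  "fv_term (V i) = {i}"
| "fv_term Zero = {}"
| "fv_term One = {}"
| "fv_term (Add s t) = fv_term s \<union> fv_term t"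
| "fv_term (Sub s t) = fv_term s \<union> fv_term t"
| "fv_term (Mul s t) = fv_term s \<union> fv_term t"
| "fv_term (Dv s t) = fv_term s \<union> fv_term t"
| "fv_term (Sc a t) = fv_term t"

datatype fmla = FEq fterm fterm | FLess fterm fterm | FNeg fmla | FConj fmla fmla
  | FEx nat fmla

fun fv_fmla :: "fmla \<Rightarrow> nat set" where
  "fv_fmla (FEq s t) = fv_term s \<union> fv_term t"
| "fv_fmla (FLess s t) = fv_term s \<union> fv_term t"
| "fv_fmla (FNeg p) = fv_fmla p"
| "fv_fmla (FConj p q) = fv_fmla p \<union> fv_fmla q"
| "fv_fmla (FEx x p) = fv_fmla p - {x}"

definition sentence :: "fmla \<Rightarrow> bool" where
  "sentence p \<longleftrightarrow> fv_fmla p = {}"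

fun fmla_in :: "(fterm \<Rightarrow> bool) \<Rightarrow> fmla \<Rightarrow> bool" where
  "fmla_in L (FEq s t) = (L s \<and> L t)"
| "fmla_in L (FLess s t) = (L s \<and> L t)"
| "fmla_in L (FNeg p) = fmla_in L p"
| "fmla_in L (FConj p q) = (fmla_in L p \<and> fmla_in L q)"
| "fmla_in L (FEx x p) = fmla_in L p"

record 'm struc =
  dom :: "'m set"
  zer :: 'm
  onef :: 'm
  addf :: "'m \<Rightarrow> 'm \<Rightarrow> 'm"
  subf :: "'m \<Rightarrow> 'm \<Rightarrow> 'm"
  mulf :: "'m \<Rightarrow> 'm \<Rightarrow> 'm"
  divf :: "'m \<Rightarrow> 'm \<Rightarrow> 'm"
  scf :: "real \<Rightarrow> 'm \<Rightarrow> 'm"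
  lessf :: "'m \<Rightarrow> 'm \<Rightarrow> bool"

fun eval :: "'m struc \<Rightarrow> (nat \<Rightarrow> 'm) \<Rightarrow> fterm \<Rightarrow> 'm" where
  "eval M e (V i) = e i"
| "eval M e Zero = zer M"
| "eval M e One = onef M"
| "eval M e (Add s t) = addf M (eval M e s) (eval M e t)"
| "eval M e (Sub s t) = subf M (eval M e s) (eval M e t)"
| "eval M e (Mul s t) = mulf M (eval M e s) (eval M e t)"
| "eval M e (Dv s t) = divf M (eval M e s) (eval M e t)"
| "eval M e (Sc a t) = scf M a (eval M e t)"

fun sat :: "'m struc \<Rightarrow> (nat \<Rightarrow> 'm) \<Rightarrow> fmla \<Rightarrow> bool" where
  "sat M e (FEq s t) = (eval M e s = eval M e t)"
| "sat M e (FLess s t) = lessf M (eval M e s) (eval M e t)"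
| "sat M e (FNeg p) = (\<not> sat M e p)"
| "sat M e (FConj p q) = (sat M e p \<and> sat M e q)"
| "sat M e (FEx x p) = (\<exists>d\<in>dom M. sat M (e(x := d)) p)"

definition is_struc :: "real set \<Rightarrow> 'm struc \<Rightarrow> bool" where
  "is_struc F M \<longleftrightarrow> dom M \<noteq> {} \<and> zer M \<in> dom M \<and> onef M \<in> dom M \<and>
     (\<forall>x\<in>dom M. \<forall>y\<in>dom M. addf M x y \<in> dom M \<and> subf M x y \<in> dom M \<and>
        mulf M x y \<in> dom M \<and> divf M x y \<in> dom M) \<and>
     (\<forall>a\<in>F. \<forall>x\<in>dom M. scf M a x \<in> dom M)"

definition env_in :: "'m struc \<Rightarrow> (nat \<Rightarrow> 'm) \<Rightarrow> bool" where
  "env_in M e \<longleftrightarrow> (\<forall>i. e i \<in> dom M)"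

text \<open>The real structure (R,0,1,+,-,*,div,<,(f_a)), with x div 0 = 0.\<close>
definition realS :: "real struc" where
  "realS = \<lparr>dom = UNIV, zer = 0, onef = 1, addf = (+), subf = (-), mulf = (*),
            divf = (/), scf = (\<lambda>a x. a * x), lessf = (<)\<rparr>"

definition T_add :: "real set \<Rightarrow> fmla set" where
  "T_add F = {p. sentence p \<and> fmla_in (add_lang F) p \<and> sat realS (\<lambda>_. 0) p}"

definition T_mult :: "real set \<Rightarrow> fmla set" where
  "T_mult F = {p. sentence p \<and> fmla_in (mult_lang F) p \<and> sat realS (\<lambda>_. 0) p}"

definition T_full :: "real set \<Rightarrow> fmla set" where
  "T_full F = T_add F \<union> T_mult F"

definition is_model :: "real set \<Rightarrow> 'm struc \<Rightarrow> bool" where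
  "is_model F M \<longleftrightarrow> is_struc F M \<and>
     (\<forall>p\<in>T_full F. \<forall>e. env_in M e \<longrightarrow> sat M e p)"

text \<open>T[F] proves the equation s = t (i.e. its universal closure).  Provability is
  rendered semantically (Goedel completeness): the universal closure holds in every
  model of T[F].  By downward Loewenheim-Skolem it suffices to consider models whose
  universe is a subset of a set of size continuum; we use carriers in type real.\<close>
definition T_proves_eq :: "real set \<Rightarrow> fterm \<Rightarrow> fterm \<Rightarrow> bool" where
  "T_proves_eq F s t \<longleftrightarrow>
     (\<forall>M :: real struc. is_model F M \<longrightarrow>
        (\<forall>e. env_in M e \<longrightarrow> eval M e s = eval M e t))"

text \<open>Abstract preterms: PAdd [(a1,t1),...,(ak,tk)] stands for a1 t1 + ... + ak tk,
  PMul [(t1,i1),...,(tk,ik)] for t1^i1 ... tk^ik.\<close>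
datatype pt = PVar nat | POne | PAdd "(real \<times> pt) list" | PMul "(pt \<times> int) list"

definition odd_above :: "nat \<Rightarrow> nat" where
  "odd_above m = (if odd m then m + 2 else m + 1)"

definition even_above :: "nat \<Rightarrow> nat" where
  "even_above m = (if odd m then m + 1 else m + 2)"

fun rank :: "pt \<Rightarrow> nat" where
  "rank (PVar i) = 0"
| "rank POne = 0"
| "rank (PAdd l) = odd_above (foldr max (map (\<lambda>p. rank (snd p)) l) 0)"
| "rank (PMul l) = even_above (foldr max (map (\<lambda>p. rank (fst p)) l) 0)"

fun is_add :: "pt \<Rightarrow> bool" where
  "is_add (PAdd l) = True" | "is_add _ = False"

fun is_mul :: "pt \<Rightarrow> bool" where
  "is_mul (PMul l) = True" | "is_mul _ = False"

fun basic_less :: "pt \<Rightarrow> pt \<Rightarrow> bool" where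
  "basic_less (PVar i) POne = True"
| "basic_less (PVar i) (PVar j) = (j < i)"
| "basic_less _ _ = False"

fun addcomps :: "pt \<Rightarrow> (real \<times> pt) list" where
  "addcomps (PAdd l) = l"
| "addcomps u = [(1, u)]"

fun mulcomps :: "pt \<Rightarrow> (pt \<times> int) list" where
  "mulcomps (PMul l) = l"
| "mulcomps POne = []"
| "mulcomps u = [(u, 1)]"

definition acoef :: "pt \<Rightarrow> pt \<Rightarrow> real" where
  "acoef s u = sum_list (map fst (filter (\<lambda>p. snd p = u) (addcomps s)))"

definition mexp :: "pt \<Rightarrow> pt \<Rightarrow> int" where
  "mexp s u = sum_list (map snd (filter (\<lambda>p. fst p = u) (mulcomps s)))"

text \<open>precf k s t: s \<prec> t, defined by recursion on the rank (k is a rank bound).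
  The lexicographic comparisons along the \<succ>-decreasing list of components are
  expressed directly: "the least index where the exponents differ" is the
  \<succ>-largest component where they differ, etc.\<close>
primrec precf :: "nat \<Rightarrow> pt \<Rightarrow> pt \<Rightarrow> bool" where
  "precf 0 s t = basic_less s t"
| "precf (Suc k) s t =
    (let n = max (rank s) (rank t) in
     if n = 0 then basic_less s t
     else if odd n then
       (let U = snd ` set (addcomps s) \<union> snd ` set (addcomps t) in
        \<exists>u\<in>U. acoef s u < acoef t u \<and> (\<forall>v\<in>U. precf k u v \<longrightarrow> acoef s v = acoef t v))
     else
       (let U = fst ` set (mulcomps s) \<union> fst ` set (mulcomps t) in
        (\<exists>u\<in>U. precf k POne u \<and> mexp s u < mexp t u \<and>
            (\<forall>v\<in>U. precf k u v \<longrightarrow> mexp s v = mexp t v)) \<or>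
        ((\<forall>u\<in>U. precf k POne u \<longrightarrow> mexp s u = mexp t u) \<and>
         (\<exists>u\<in>U. precf k u POne \<and> mexp t u < mexp s u \<and>
            (\<forall>v\<in>U. precf k v u \<longrightarrow> mexp s v = mexp t v)))))"

definition prec :: "pt \<Rightarrow> pt \<Rightarrow> bool" where
  "prec s t = precf (max (rank s) (rank t)) s t"

fun nf :: "real set \<Rightarrow> pt \<Rightarrow> bool" where
  "nf F (PVar i) = True"
| "nf F POne = True"
| "nf F (PAdd l) = (2 \<le> length l \<and>
     (\<forall>p\<in>set l. fst p \<in> F \<and> fst p \<noteq> 0 \<and> \<not> is_add (snd p) \<and> nf F (snd p)) \<and>
     fst (hd l) = 1 \<and>
     (\<forall>i. Suc i < length l \<longrightarrow> prec (snd (l ! Suc i)) (snd (l ! i))))"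
| "nf F (PMul l) = (l \<noteq> [] \<and> (2 \<le> length l \<or> snd (hd l) \<noteq> 1) \<and>
     (\<forall>p\<in>set l. snd p \<noteq> 0 \<and> fst p \<noteq> POne \<and> \<not> is_mul (fst p) \<and> nf F (fst p)) \<and>
     (\<forall>i. Suc i < length l \<longrightarrow> prec (fst (l ! Suc i)) (fst (l ! i))))"

fun iprod :: "fterm \<Rightarrow> nat \<Rightarrow> fterm" where
  "iprod t 0 = One"
| "iprod t (Suc 0) = t"
| "iprod t (Suc (Suc n)) = Mul (iprod t (Suc n)) t"

definition ipow :: "fterm \<Rightarrow> int \<Rightarrow> fterm" where
  "ipow t i = (if 0 < i then iprod t (nat i) else Dv One (iprod t (nat (- i))))"

fun render :: "pt \<Rightarrow> fterm" where
  "render (PVar i) = V i"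
| "render POne = One"
| "render (PAdd []) = Zero"
| "render (PAdd (p # l)) =
     foldl (\<lambda>acc q. Add acc (Sc (fst q) (render (snd q)))) (Sc (fst p) (render (snd p))) l"
| "render (PMul []) = One"
| "render (PMul (p # l)) =
     foldl (\<lambda>acc q. Mul acc (ipow (render (fst q)) (snd q))) (ipow (render (fst p)) (snd p)) l"

definition nf_term :: "real set \<Rightarrow> fterm \<Rightarrow> bool" where
  "nf_term F s \<longleftrightarrow> s = Zero \<or> (\<exists>a p. a \<in> F \<and> a \<noteq> 0 \<and> nf F p \<and> s = Sc a (render p))"

end

theory Submission
  imports Defs "HOL-Library.Poly_Mapping" "HOL-Library.Product_Lexorder" "HOL-Analysis.Product_Vector"
    "HOL-Analysis.Abstract_Topology_2"
begin

text \<open>It suffices to find one model of \<open>T[F]\<close> and one assignment under which the given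
  normal forms take different values. Fix the ordered real vector space \<open>V\<close> of finitely
  supported functions on the reals, ordered lexicographically. Any order isomorphism \<open>E\<close>
  from an ordered real vector space onto the positive part of \<open>V\<close> that turns a distinguished
  direction into scalar multiplication makes \<open>V\<close> a model: its multiplication is addition
  of logarithms, and quantifier elimination for ordered vector spaces gives both theories. No
  distributivity ties \<open>E\<close> to addition beyond scalars, so \<open>E\<close> can be perturbed on tiny
  cosets. Going through the subterms by rank, each new sum is given a logarithm independent of the
  earlier logarithms, and each new product a value linearly independent of the earlier values; then
  values determine coefficients and exponents, hence normal forms. The order on preterms only serves
  to make sorted lists of components unique; it is linear on non-additive and on non-multiplicative
  normal forms separately, but not on their union.\<close>

section \<open>Elimination in ordered real vector spaces\<close>

text \<open>The real field obeys distributivity, so it cannot separate a power of a sum from its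
  expansion; and over a one-dimensional logarithm space the law
  \<open>E (l + r *\<^sub>R u) = exp r *\<^sub>R E l\<close> already determines the exponential.
  Room for perturbation comes from infinitesimals: finitely many finitely supported vectors use
  finitely many keys, so some key lies beyond all of them, and a vector there is negligible against
  all nonzero vectors in sight and outside their span. The keys are real so that an exponential
  exists: the leading key of a positive vector serves as a coordinate of its logarithm, hence has to
  range over an ordered real vector space, and the keys beyond it have again the order type of all
  keys. What must be excluded throughout is collinearity over the reals and not just equality,
  because moving a logarithm along the distinguished direction only rescales the value. Finally,
  provability is tested on models whose carrier consists of reals, so the vector space has to be
  injected into the reals.\<close>

type_synonym form = "(real \<times> nat) list \<times> real"

text \<open>The unit \<open>u\<close> is 1 on the additive side and the logarithm of
  \<open>exp 1\<close> on the multiplicative side. Coefficients are arbitrary reals because a scalar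
  \<open>a\<close> enters a logarithm as \<open>ln \<bar>a\<bar>\<close>, which need not lie in
  \<open>F\<close>.\<close>

definition fval :: "'v::real_vector \<Rightarrow> (nat \<Rightarrow> 'v) \<Rightarrow> form \<Rightarrow> 'v" where
  "fval u e f = (\<Sum>p\<leftarrow>fst f. fst p *\<^sub>R e (snd p)) + snd f *\<^sub>R u"

definition drop_var :: "nat \<Rightarrow> form \<Rightarrow> form" where
  "drop_var x f = (filter (\<lambda>p. snd p \<noteq> x) (fst f), snd f)"

definition coef :: "nat \<Rightarrow> form \<Rightarrow> real" where
  "coef x f = (\<Sum>p\<leftarrow>filter (\<lambda>p. snd p = x) (fst f). fst p)"

definition fscale :: "real \<Rightarrow> form \<Rightarrow> form" where
  "fscale c f = (map (\<lambda>p. (c * fst p, snd p)) (fst f), c * snd f)"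

definition fadd :: "form \<Rightarrow> form \<Rightarrow> form" where
  "fadd f g = (fst f @ fst g, snd f + snd g)"

definition fsub :: "form \<Rightarrow> form \<Rightarrow> form" where
  "fsub f g = fadd f (fscale (-1) g)"

lemma fval_fscale: "fval u e (fscale c f) = c *\<^sub>R fval u e f"
proof -
  have "(\<Sum>p\<leftarrow>map (\<lambda>p. (c * fst p, snd p)) l. fst p *\<^sub>R e (snd p))
      = c *\<^sub>R (\<Sum>p\<leftarrow>l. fst p *\<^sub>R e (snd p))" for l :: "(real \<times> nat) list"
    by (induction l) (auto simp: scaleR_add_right)
  then show ?thesis by (simp add: fval_def fscale_def scaleR_add_right)
qed

lemma fval_fadd: "fval u e (fadd f g) = fval u e f + fval u e g"
  by (simp add: fval_def fadd_def scaleR_add_left)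

lemma fval_fsub: "fval u e (fsub f g) = fval u e f - fval u e g"
  by (simp add: fsub_def fval_fadd fval_fscale)

lemma fval_upd: "fval u (e(x := d)) f = coef x f *\<^sub>R d + fval u e (drop_var x f)"
proof -
  have "(\<Sum>p\<leftarrow>l. fst p *\<^sub>R (e(x := d)) (snd p))
      = (\<Sum>p\<leftarrow>filter (\<lambda>p. snd p = x) l. fst p) *\<^sub>R d
        + (\<Sum>p\<leftarrow>filter (\<lambda>p. snd p \<noteq> x) l. fst p *\<^sub>R e (snd p))" for l :: "(real \<times> nat) list"
    by (induction l) (auto simp: scaleR_add_left)
  then show ?thesis by (simp add: fval_def coef_def drop_var_def)
qed

lemma fval_zero: "fval u (\<lambda>_. 0) f = snd f *\<^sub>R u"
proof -
  have "(\<Sum>p\<leftarrow>l. fst p *\<^sub>R (0::'a)) = 0" for l :: "(real \<times> nat) list"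
    by (induction l) auto
  then show ?thesis by (simp add: fval_def)
qed

definition var_root :: "nat \<Rightarrow> form \<Rightarrow> form" where
  "var_root x f = fscale (- 1 / coef x f) (drop_var x f)"

text \<open>The sign of a form that involves \<open>x\<close> is thus decided by the side of its
  root on which the value of \<open>x\<close> lies.\<close>

lemma fval_upd_var_root:
  assumes "coef x f \<noteq> 0"
  shows "fval u (e(x := d)) f = coef x f *\<^sub>R (d - fval u e (var_root x f))"
  using assms by (simp add: fval_upd var_root_def fval_fscale scaleR_add_right)

text \<open>Differences of roots record the order of the roots. Every form is also kept with
  \<open>x\<close> dropped, even if it involves \<open>x\<close>: its value at \<open>x = 0\<close>
  is needed when \<open>x\<close> names a zero element, whose logarithm is 0 by convention.\<close>

definition elim_var :: "nat \<Rightarrow> form set \<Rightarrow> form set" where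
  "elim_var x S = drop_var x ` S \<union>
     (\<lambda>(f, g). fsub (var_root x f) (var_root x g)) ` ({f \<in> S. coef x f \<noteq> 0} \<times> {f \<in> S. coef x f \<noteq> 0})"

lemma finite_elim_var: "finite S \<Longrightarrow> finite (elim_var x S)"
  by (simp add: elim_var_def)

text \<open>The invariant of the back-and-forth. Only signs of the forms in \<open>S\<close> are
  compared, so one formula needs finite information; the two spaces may differ in type, since one of
  them will be the reals.\<close>

definition agree :: "form set \<Rightarrow> 'v::{real_vector,linorder} \<Rightarrow> (nat \<Rightarrow> 'v) \<Rightarrow>
    'w::{real_vector,linorder} \<Rightarrow> (nat \<Rightarrow> 'w) \<Rightarrow> bool" where
  "agree S u e u' e' \<longleftrightarrow> (\<forall>f\<in>S. (0 < fval u e f \<longleftrightarrow> 0 < fval u' e' f) \<and>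
     (fval u e f < 0 \<longleftrightarrow> fval u' e' f < 0))"

lemma agree_sym: "agree S u e u' e' \<Longrightarrow> agree S u' e' u e"
  by (auto simp: agree_def)

lemma agree_mono: "agree S u e u' e' \<Longrightarrow> T \<subseteq> S \<Longrightarrow> agree T u e u' e'"
  by (auto simp: agree_def)

lemma agree_zero_iff:
  "agree S u e u' e' \<Longrightarrow> f \<in> S \<Longrightarrow> fval u e f = 0 \<longleftrightarrow> fval u' e' f = 0"
  unfolding agree_def by (metis less_irrefl linorder_neqE)

lemma zero_less_scaleR_iff:
  fixes y :: "'v::{ordered_real_vector,linordered_ab_group_add}"
  shows "0 < c *\<^sub>R y \<longleftrightarrow> 0 < c \<and> 0 < y \<or> c < 0 \<and> y < 0"
  by (auto simp: less_le zero_le_scaleR_iff)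

lemma scaleR_less_zero_iff:
  fixes y :: "'v::{ordered_real_vector,linordered_ab_group_add}"
  shows "c *\<^sub>R y < 0 \<longleftrightarrow> 0 < c \<and> y < 0 \<or> c < 0 \<and> 0 < y"
  by (auto simp: less_le scaleR_le_0_iff)

lemma between:
  fixes a b :: "'v::{ordered_real_vector,linordered_ab_group_add}"
  assumes "a < b"
  shows "a < (1/2) *\<^sub>R (a + b)" "(1/2) *\<^sub>R (a + b) < b"
proof -
  have "0 < (1/2) *\<^sub>R (b - a)" using assms by (simp add: zero_less_scaleR_iff)
  moreover have "(1/2) *\<^sub>R (a + b) = a + (1/2) *\<^sub>R (b - a)"
    "b = (1/2) *\<^sub>R (a + b) + (1/2) *\<^sub>R (b - a)"
    by (simp_all add: algebra_simps flip: scaleR_add_left)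
  ultimately show "a < (1/2) *\<^sub>R (a + b)" "(1/2) *\<^sub>R (a + b) < b"
    by (metis less_add_same_cancel1)+
qed

text \<open>Density without endpoints. If \<open>d\<close> hits some \<open>r i\<close>, its
  counterpart is \<open>r' i\<close>; otherwise \<open>d\<close> cuts the finite family in two, and
  the cut is filled by a midpoint, or by a step of \<open>u\<close> beyond the extreme element when
  one side is empty.\<close>

lemma same_position:
  fixes r :: "'i \<Rightarrow> 'a::linorder"
    and r' :: "'i \<Rightarrow> 'w::{ordered_real_vector,linordered_ab_group_add}" and u :: 'w
  assumes fin: "finite I" and u: "0 < u"
    and ord: "\<And>i j. i \<in> I \<Longrightarrow> j \<in> I \<Longrightarrow> r i < r j \<longleftrightarrow> r' i < r' j"
  shows "\<exists>d'. \<forall>i\<in>I. (r i < d \<longleftrightarrow> r' i < d') \<and> (d < r i \<longleftrightarrow> d' < r' i)"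
proof (cases "\<exists>i\<in>I. r i = d")
  case True
  then obtain i where "i \<in> I" "r i = d" by blast
  then show ?thesis using ord by (intro exI[of _ "r' i"]) auto
next
  case False
  define A where "A = {i \<in> I. r i < d}"
  define B where "B = {i \<in> I. d < r i}"
  have AB: "A \<union> B = I" "finite A" "finite B" using False fin by (auto simp: A_def B_def)
  have lt: "r' i < r' j" if "i \<in> A" "j \<in> B" for i j
    using that ord[of i j] by (auto simp: A_def B_def)
  have "\<exists>d'. (\<forall>i\<in>A. r' i < d') \<and> (\<forall>i\<in>B. d' < r' i)"
  proof (cases "A = {}"; cases "B = {}")
    assume "A = {}" "B \<noteq> {}"
    have "Min (r' ` B) - u < r' i" if "i \<in> B" for i
    proof -
      have "Min (r' ` B) - u < Min (r' ` B)" using u by simp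
      also have "\<dots> \<le> r' i" using that AB by simp
      finally show ?thesis .
    qed
    then show ?thesis using \<open>A = {}\<close> by blast
  next
    assume "A \<noteq> {}" "B = {}"
    have "r' i < Max (r' ` A) + u" if "i \<in> A" for i
    proof -
      have "r' i \<le> Max (r' ` A)" using that AB by simp
      also have "\<dots> < Max (r' ` A) + u" using u by simp
      finally show ?thesis .
    qed
    then show ?thesis using \<open>B = {}\<close> by blast
  next
    assume ne: "A \<noteq> {}" "B \<noteq> {}"
    define a b where "a = Max (r' ` A)" and "b = Min (r' ` B)"
    have "a \<in> r' ` A" "b \<in> r' ` B"
      using AB ne by (simp_all add: a_def b_def)
    then have "a < b" using lt by auto
    moreover have "r' i \<le> a" if "i \<in> A" for i using that AB by (simp add: a_def)
    moreover have "b \<le> r' i" if "i \<in> B" for i using that AB by (simp add: b_def)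
    ultimately show ?thesis using between[of a b] by (meson le_less_trans less_le_trans)
  qed auto
  then obtain d' where "\<forall>i\<in>A. r' i < d'" "\<forall>i\<in>B. d' < r' i" by blast
  then show ?thesis
    by (intro exI[of _ d']) (auto simp: A_def B_def, (metis False linorder_neqE not_less_iff_gr_or_eq)+)
qed

lemma scaleR_sign_iff:
  fixes y :: "'v::{ordered_real_vector,linordered_ab_group_add}"
  assumes "c \<noteq> 0"
  shows "0 < c *\<^sub>R y \<longleftrightarrow> (if 0 < c then 0 < y else y < 0)"
    and "c *\<^sub>R y < 0 \<longleftrightarrow> (if 0 < c then y < 0 else 0 < y)"
  using assms by (auto simp: zero_less_scaleR_iff scaleR_less_zero_iff not_less_iff_gr_or_eq)

text \<open>One round of the back-and-forth: the Fourier--Motzkin step.\<close>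

lemma agree_elim_var:
  fixes u :: "'v::{ordered_real_vector,linordered_ab_group_add}"
    and u' :: "'w::{ordered_real_vector,linordered_ab_group_add}"
  assumes ag: "agree (elim_var x S) u e u' e'" and fin: "finite S" and u': "0 < u'"
  shows "\<exists>d'. agree S u (e(x := d)) u' (e'(x := d'))"
proof -
  define I where "I = {f \<in> S. coef x f \<noteq> 0}"
  have "\<exists>d'. \<forall>f\<in>I. (fval u e (var_root x f) < d \<longleftrightarrow> fval u' e' (var_root x f) < d') \<and>
      (d < fval u e (var_root x f) \<longleftrightarrow> d' < fval u' e' (var_root x f))"
  proof (rule same_position)
    show "finite I" using fin by (simp add: I_def)
    show "0 < u'" by fact
    fix f g assume "f \<in> I" "g \<in> I"
    then have "fsub (var_root x f) (var_root x g) \<in> elim_var x S"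
      by (auto simp: elim_var_def I_def)
    then show "fval u e (var_root x f) < fval u e (var_root x g) \<longleftrightarrow>
        fval u' e' (var_root x f) < fval u' e' (var_root x g)"
      using ag by (auto simp: agree_def fval_fsub)
  qed
  then obtain d' where d': "\<And>f. f \<in> I \<Longrightarrow> (fval u e (var_root x f) < d \<longleftrightarrow> fval u' e' (var_root x f) < d') \<and>
      (d < fval u e (var_root x f) \<longleftrightarrow> d' < fval u' e' (var_root x f))" by blast
  have "(0 < fval u (e(x := d)) f \<longleftrightarrow> 0 < fval u' (e'(x := d')) f) \<and>
      (fval u (e(x := d)) f < 0 \<longleftrightarrow> fval u' (e'(x := d')) f < 0)" if f: "f \<in> S" for f
  proof (cases "coef x f = 0")
    case True
    have "drop_var x f \<in> elim_var x S" using f by (auto simp: elim_var_def)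
    then show ?thesis using ag True by (simp add: fval_upd agree_def)
  next
    case False
    then have "f \<in> I" using f by (simp add: I_def)
    then show ?thesis using d' False by (simp add: fval_upd_var_root scaleR_sign_iff)
  qed
  then show ?thesis by (auto simp: agree_def)
qed

section \<open>Models of the additive and of the multiplicative theory\<close>

lemma eval_cong: "(\<And>i. i \<in> fv_term t \<Longrightarrow> e i = e' i) \<Longrightarrow> eval M e t = eval M e' t"
  by (induction t) auto

lemma sat_cong: "(\<And>i. i \<in> fv_fmla p \<Longrightarrow> e i = e' i) \<Longrightarrow> sat M e p = sat M e' p"
proof (induction p arbitrary: e e')
  case (FEq s t)
  then show ?case using eval_cong[of s e e' M] eval_cong[of t e e' M] by auto
next
  case (FLess s t)
  then show ?case using eval_cong[of s e e' M] eval_cong[of t e e' M] by auto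
next
  case (FConj p q)
  have "sat M e p = sat M e' p" "sat M e q = sat M e' q"
    using FConj.prems by (intro FConj.IH; simp)+
  then show ?case by simp
next
  case (FEx x p)
  have "sat M (e(x := d)) p = sat M (e'(x := d)) p" for d
    using FEx.prems by (intro FEx.IH) auto
  then show ?case by simp
next
  case (FNeg p)
  have "sat M e p = sat M e' p" using FNeg.prems by (intro FNeg.IH) simp
  then show ?case by simp
qed

text \<open>Multiplication and division stay unconstrained: formulas of the additive language do not
  mention them, which leaves them to the exponential.\<close>

definition add_struc :: "'v::{ordered_real_vector,linordered_ab_group_add} struc \<Rightarrow> bool" where
  "add_struc M \<longleftrightarrow> dom M = UNIV \<and> zer M = 0 \<and> 0 < onef M \<and> addf M = (+) \<and> subf M = (-) \<and>
     scf M = (*\<^sub>R) \<and> lessf M = (<)"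

text \<open>The last equation is correct for \<open>Zero\<close> and a dummy value for products and
  quotients, which the additive language excludes.\<close>

fun add_form :: "fterm \<Rightarrow> form" where
  "add_form (V i) = ([(1, i)], 0)"
| "add_form One = ([], 1)"
| "add_form (Add s t) = fadd (add_form s) (add_form t)"
| "add_form (Sub s t) = fsub (add_form s) (add_form t)"
| "add_form (Sc a t) = fscale a (add_form t)"
| "add_form _ = ([], 0)"

lemma eval_add_form:
  assumes "add_struc M"
  shows "add_lang F t \<Longrightarrow> eval M e t = fval (onef M) e (add_form t)"
  using assms
  by (induction t) (auto simp: add_struc_def fval_fadd fval_fsub fval_fscale, auto simp: fval_def)

text \<open>The finite set is chosen before the assignments, so a quantifier is handled by passing
  from \<open>S\<close> to \<open>elim_var x S\<close>; agreement is symmetric, so a witness on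
  either side is answered on the other. No quantifier-free equivalent is ever constructed.\<close>

lemma add_struc_agree:
  fixes M :: "'v::{ordered_real_vector,linordered_ab_group_add} struc"
    and N :: "'w::{ordered_real_vector,linordered_ab_group_add} struc"
  assumes M: "add_struc M" and N: "add_struc N" and "fmla_in (add_lang F) p"
  shows "\<exists>S. finite S \<and> (\<forall>e e'. agree S (onef M) e (onef N) e' \<longrightarrow> sat M e p = sat N e' p)"
  using assms(3)
proof (induction p)
  case (FEq s t)
  have "sat M e (FEq s t) = sat N e' (FEq s t)"
    if "agree {fsub (add_form s) (add_form t)} (onef M) e (onef N) e'" for e e'
    using agree_zero_iff[OF that] FEq
    by (auto simp: eval_add_form[OF M] eval_add_form[OF N] fval_fsub)
  then show ?case by (intro exI[of _ "{fsub (add_form s) (add_form t)}"]) blast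
next
  case (FLess s t)
  have lt: "lessf M = (<)" "lessf N = (<)" using M N by (auto simp: add_struc_def)
  have "sat M e (FLess s t) = sat N e' (FLess s t)"
    if "agree {fsub (add_form s) (add_form t)} (onef M) e (onef N) e'" for e e'
    using that FLess
    by (auto simp: eval_add_form[OF M] eval_add_form[OF N] fval_fsub agree_def lt)
  then show ?case by (intro exI[of _ "{fsub (add_form s) (add_form t)}"]) blast
next
  case (FNeg p)
  then show ?case by auto
next
  case (FConj p q)
  then obtain S T where "finite S" "finite T"
    "\<And>e e'. agree S (onef M) e (onef N) e' \<Longrightarrow> sat M e p = sat N e' p"
    "\<And>e e'. agree T (onef M) e (onef N) e' \<Longrightarrow> sat M e q = sat N e' q"
    by (metis fmla_in.simps(4))
  then show ?case
    by (intro exI[of _ "S \<union> T"]) (auto dest: agree_mono[where T = S] agree_mono[where T = T])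
next
  case (FEx x p)
  then obtain S where S: "finite S"
    "\<And>e e'. agree S (onef M) e (onef N) e' \<Longrightarrow> sat M e p = sat N e' p"
    by auto
  have pos: "0 < onef M" "0 < onef N" "dom M = UNIV" "dom N = UNIV"
    using M N by (auto simp: add_struc_def)
  have "sat M e (FEx x p) = sat N e' (FEx x p)"
    if ag: "agree (elim_var x S) (onef M) e (onef N) e'" for e e'
    using agree_elim_var[OF ag S(1) pos(2)] agree_elim_var[OF agree_sym[OF ag] S(1) pos(1)]
    by (auto simp: pos) (metis S(2), metis S(2) agree_sym)
  then show ?case using finite_elim_var[OF S(1)] by blast
qed

lemma add_struc_realS: "add_struc realS"
  by (simp add: add_struc_def realS_def fun_eq_iff)

text \<open>At the zero assignments every form reduces to its constant part, whose sign is that of a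
  real coefficient because both units are positive. So these assignments agree on any
  \<open>S\<close>, and the truth of a sentence does not depend on the assignment.\<close>

lemma sat_T_add:
  fixes M :: "'v::{ordered_real_vector,linordered_ab_group_add} struc"
  assumes M: "add_struc M" and p: "p \<in> T_add F"
  shows "sat M e p"
proof -
  obtain S where S: "\<And>e e'. agree S (onef M) e (onef realS) e' \<Longrightarrow> sat M e p = sat realS e' p"
    using add_struc_agree[OF M add_struc_realS] p by (force simp: T_add_def)
  have "0 < onef M" using M by (simp add: add_struc_def)
  then have "agree S (onef M) (\<lambda>_. 0) (onef realS) (\<lambda>_. 0)"
    by (auto simp: agree_def fval_zero realS_def zero_less_scaleR_iff scaleR_less_zero_iff)
  then have "sat M (\<lambda>_. 0) p" using S p by (simp add: T_add_def)
  moreover have "sat M (\<lambda>_. 0) p = sat M e p"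
    using p by (intro sat_cong) (simp add: T_add_def sentence_def)
  ultimately show ?thesis by simp
qed

text \<open>An element is coded by its sign and the logarithm of its absolute value, which lives in an
  ordered real vector space in which \<open>ln r *\<^sub>R u\<close> is the logarithm of the
  positive scalar \<open>r\<close>. This makes the multiplicative theory additive.\<close>

locale mult_struc =
  fixes M :: "'m struc" and sg :: "'m \<Rightarrow> real"
    and lg :: "'m \<Rightarrow> 'l::{ordered_real_vector,linordered_ab_group_add}" and u :: 'l
  assumes dom: "dom M = UNIV" and u: "0 < u"
    and sg_range: "sg x = 1 \<or> sg x = 0 \<or> sg x = -1"
    and inj: "sg x = sg y \<Longrightarrow> (sg x \<noteq> 0 \<Longrightarrow> lg x = lg y) \<Longrightarrow> x = y"
    and surj: "s = 1 \<or> s = -1 \<Longrightarrow> \<exists>x. sg x = s \<and> lg x = l"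
    and zero: "sg (zer M) = 0" "lg (zer M) = 0"
    and one: "sg (onef M) = 1" "lg (onef M) = 0"
    and sg_mul: "sg (mulf M x y) = sg x * sg y"
    and lg_mul: "sg x \<noteq> 0 \<Longrightarrow> sg y \<noteq> 0 \<Longrightarrow> lg (mulf M x y) = lg x + lg y"
    and sg_div: "sg (divf M x y) = sg x * sg y"
    and lg_div: "sg x \<noteq> 0 \<Longrightarrow> sg y \<noteq> 0 \<Longrightarrow> lg (divf M x y) = lg x - lg y"
    and sg_sc: "sg (scf M a x) = sgn a * sg x"
    and lg_sc: "a \<noteq> 0 \<Longrightarrow> sg x \<noteq> 0 \<Longrightarrow> lg (scf M a x) = ln \<bar>a\<bar> *\<^sub>R u + lg x"
    and less: "lessf M x y \<longleftrightarrow> sg x < sg y \<or>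
      sg x = sg y \<and> (sg x = 1 \<and> lg x < lg y \<or> sg x = -1 \<and> lg y < lg x)"

text \<open>A quotient has the sign of the product: a nonzero sign is its own inverse, and a zero
  divisor gives 0, as \<open>x div 0 = 0\<close> demands.\<close>

fun sign_of :: "(nat \<Rightarrow> real) \<Rightarrow> fterm \<Rightarrow> real" where
  "sign_of \<sigma> (V i) = \<sigma> i"
| "sign_of \<sigma> One = 1"
| "sign_of \<sigma> (Mul s t) = sign_of \<sigma> s * sign_of \<sigma> t"
| "sign_of \<sigma> (Dv s t) = sign_of \<sigma> s * sign_of \<sigma> t"
| "sign_of \<sigma> (Sc a t) = sgn a * sign_of \<sigma> t"
| "sign_of \<sigma> _ = 0"

text \<open>Meaningful only for terms of nonzero sign; in particular \<open>ln \<bar>a\<bar>\<close>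
  is harmless at \<open>a = 0\<close>, where the sign already vanishes.\<close>

fun log_form :: "fterm \<Rightarrow> form" where
  "log_form (V i) = ([(1, i)], 0)"
| "log_form (Mul s t) = fadd (log_form s) (log_form t)"
| "log_form (Dv s t) = fsub (log_form s) (log_form t)"
| "log_form (Sc a t) = fadd ([], ln \<bar>a\<bar>) (log_form t)"
| "log_form _ = ([], 0)"

context mult_struc
begin

lemma sg_eval: "mult_lang F t \<Longrightarrow> sg (eval M e t) = sign_of (\<lambda>i. sg (e i)) t"
  by (induction t) (auto simp: zero one sg_mul sg_div sg_sc)

lemma lg_eval:
  "mult_lang F t \<Longrightarrow> sg (eval M e t) \<noteq> 0 \<Longrightarrow> lg (eval M e t) = fval u (\<lambda>i. lg (e i)) (log_form t)"
  by (induction t)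
    (auto simp: zero one sg_mul sg_div sg_sc lg_mul lg_div lg_sc fval_fadd fval_fsub,
      auto simp: fval_def sgn_eq_0_iff lg_sc)

lemma eq_iff: "x = y \<longleftrightarrow> sg x = sg y \<and> (sg x = 0 \<or> lg x = lg y)"
  using inj by blast

end

text \<open>Signs are finite data and are copied exactly; only logarithms of nonzero elements need
  the linear back-and-forth.\<close>

lemma mult_struc_agree_step:
  assumes M: "mult_struc M sg lg u" and N: "mult_struc N sg' lg' u'"
    and sgs: "\<forall>i. sg (e i) = sg' (e' i)" and fin: "finite S"
    and ag: "agree (elim_var x S) u (\<lambda>i. lg (e i)) u' (\<lambda>i. lg' (e' i))"
  shows "\<exists>d'. (\<forall>i. sg ((e(x := d)) i) = sg' ((e'(x := d')) i)) \<and>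
    agree S u (\<lambda>i. lg ((e(x := d)) i)) u' (\<lambda>i. lg' ((e'(x := d')) i))"
proof (cases "sg d = 0")
  case True
  have upd: "(\<lambda>i. f ((g(x := z)) i)) = (\<lambda>i. f (g i))(x := f z)" for f g z by auto
  have d: "d = zer M"
    using True by (intro mult_struc.inj[OF M]) (auto simp: mult_struc.zero[OF M])
  \<comment> \<open>Zero has logarithm 0 on both sides, so after the update each form equals its
    version with \<open>x\<close> dropped, and those belong to \<open>elim_var x S\<close>.\<close>
  have "agree S u ((\<lambda>i. lg (e i))(x := 0)) u' ((\<lambda>i. lg' (e' i))(x := 0))"
    using ag by (auto simp: agree_def fval_upd elim_var_def)
  then show ?thesis using sgs unfolding upd d
    by (intro exI[of _ "zer N"]) (simp add: mult_struc.zero[OF M] mult_struc.zero[OF N])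
next
  case False
  have upd: "(\<lambda>i. f ((g(x := z)) i)) = (\<lambda>i. f (g i))(x := f z)" for f g z by auto
  obtain l' where l': "agree S u ((\<lambda>i. lg (e i))(x := lg d)) u' ((\<lambda>i. lg' (e' i))(x := l'))"
    using agree_elim_var[OF ag fin mult_struc.u[OF N]] by blast
  obtain d' where "sg' d' = sg d" "lg' d' = l'"
    using mult_struc.surj[OF N] mult_struc.sg_range[OF M] False by metis
  then show ?thesis using sgs l' unfolding upd by (intro exI[of _ d']) simp
qed

lemma mult_struc_agree:
  assumes M: "mult_struc M sg lg u" and N: "mult_struc N sg' lg' u'"
    and "fmla_in (mult_lang F) p"
  shows "\<exists>S. finite S \<and> (\<forall>e e'. (\<forall>i. sg (e i) = sg' (e' i)) \<longrightarrow>
    agree S u (\<lambda>i. lg (e i)) u' (\<lambda>i. lg' (e' i)) \<longrightarrow> sat M e p = sat N e' p)"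
  using assms(3)
proof (induction p)
  case (FEq s t)
  have "sat M e (FEq s t) = sat N e' (FEq s t)"
    if sgs: "\<forall>i. sg (e i) = sg' (e' i)"
      and ag: "agree {fsub (log_form s) (log_form t)} u (\<lambda>i. lg (e i)) u' (\<lambda>i. lg' (e' i))" for e e'
  \<comment> \<open>Unequal or zero signs decide the atom by themselves; logarithms matter only for
    a common nonzero sign.\<close>
  proof (cases "sign_of (\<lambda>i. sg (e i)) s = sign_of (\<lambda>i. sg (e i)) t \<and> sign_of (\<lambda>i. sg (e i)) t \<noteq> 0")
    case True
    then show ?thesis using agree_zero_iff[OF ag] FEq sgs
      by (auto simp: mult_struc.eq_iff[OF M] mult_struc.eq_iff[OF N]
          mult_struc.sg_eval[OF M] mult_struc.sg_eval[OF N]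
          mult_struc.lg_eval[OF M] mult_struc.lg_eval[OF N] fval_fsub)
  next
    case False
    then show ?thesis using FEq sgs
      by (auto simp: mult_struc.eq_iff[OF M] mult_struc.eq_iff[OF N]
          mult_struc.sg_eval[OF M] mult_struc.sg_eval[OF N])
  qed
  then show ?case by (intro exI[of _ "{fsub (log_form s) (log_form t)}"]) blast
next
  case (FLess s t)
  have "sat M e (FLess s t) = sat N e' (FLess s t)"
    if sgs: "\<forall>i. sg (e i) = sg' (e' i)"
      and ag: "agree {fsub (log_form s) (log_form t)} u (\<lambda>i. lg (e i)) u' (\<lambda>i. lg' (e' i))" for e e'
  proof (cases "sign_of (\<lambda>i. sg (e i)) s = sign_of (\<lambda>i. sg (e i)) t \<and> sign_of (\<lambda>i. sg (e i)) t \<noteq> 0")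
    case True
    then show ?thesis using ag FLess sgs
      by (auto simp: mult_struc.less[OF M] mult_struc.less[OF N]
          mult_struc.sg_eval[OF M] mult_struc.sg_eval[OF N]
          mult_struc.lg_eval[OF M] mult_struc.lg_eval[OF N] fval_fsub agree_def)
  next
    case False
    then show ?thesis using FLess sgs
      by (auto simp: mult_struc.less[OF M] mult_struc.less[OF N]
          mult_struc.sg_eval[OF M] mult_struc.sg_eval[OF N])
  qed
  then show ?case by (intro exI[of _ "{fsub (log_form s) (log_form t)}"]) blast
next
  case (FNeg p)
  then show ?case by auto
next
  case (FConj p q)
  then obtain S where S: "finite S" "\<And>e e'. \<forall>i. sg (e i) = sg' (e' i) \<Longrightarrow>
    agree S u (\<lambda>i. lg (e i)) u' (\<lambda>i. lg' (e' i)) \<Longrightarrow> sat M e p = sat N e' p"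
    by auto
  obtain T where T: "finite T" "\<And>e e'. \<forall>i. sg (e i) = sg' (e' i) \<Longrightarrow>
    agree T u (\<lambda>i. lg (e i)) u' (\<lambda>i. lg' (e' i)) \<Longrightarrow> sat M e q = sat N e' q"
    using FConj by auto
  have "sat M e (FConj p q) = sat N e' (FConj p q)"
    if sgs: "\<forall>i. sg (e i) = sg' (e' i)"
      and ag: "agree (S \<union> T) u (\<lambda>i. lg (e i)) u' (\<lambda>i. lg' (e' i))" for e e'
    using S(2)[OF sgs agree_mono[OF ag]] T(2)[OF sgs agree_mono[OF ag]] by simp
  then show ?case using S(1) T(1) by (intro exI[of _ "S \<union> T"]) blast
next
  case (FEx x p)
  then obtain S where S: "finite S" "\<And>e e'. \<forall>i. sg (e i) = sg' (e' i) \<Longrightarrow>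
    agree S u (\<lambda>i. lg (e i)) u' (\<lambda>i. lg' (e' i)) \<Longrightarrow> sat M e p = sat N e' p"
    by auto
  have "sat M e (FEx x p) = sat N e' (FEx x p)"
    if sgs: "\<forall>i. sg (e i) = sg' (e' i)"
      and ag: "agree (elim_var x S) u (\<lambda>i. lg (e i)) u' (\<lambda>i. lg' (e' i))" for e e'
  proof
    assume "sat M e (FEx x p)"
    then obtain d where d: "sat M (e(x := d)) p" by auto
    obtain d' where "\<forall>i. sg ((e(x := d)) i) = sg' ((e'(x := d')) i)"
      "agree S u (\<lambda>i. lg ((e(x := d)) i)) u' (\<lambda>i. lg' ((e'(x := d')) i))"
      using mult_struc_agree_step[OF M N sgs S(1) ag, of d] by blast
    from S(2)[of "e(x := d)" "e'(x := d')", OF this] d have "sat N (e'(x := d')) p" by simp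
    then show "sat N e' (FEx x p)" using mult_struc.dom[OF N] by auto
  next
    assume "sat N e' (FEx x p)"
    then obtain d' where d': "sat N (e'(x := d')) p" by auto
    have "\<forall>i. sg' (e' i) = sg (e i)" using sgs by simp
    then obtain d where "\<forall>i. sg' ((e'(x := d')) i) = sg ((e(x := d)) i)"
      "agree S u' (\<lambda>i. lg' ((e'(x := d')) i)) u (\<lambda>i. lg ((e(x := d)) i))"
      using mult_struc_agree_step[OF N M _ S(1) agree_sym[OF ag], of d'] by blast
    then have "\<forall>i. sg ((e(x := d)) i) = sg' ((e'(x := d')) i)"
      "agree S u (\<lambda>i. lg ((e(x := d)) i)) u' (\<lambda>i. lg' ((e'(x := d')) i))"
      by (simp_all add: agree_sym)
    from S(2)[of "e(x := d)" "e'(x := d')", OF this] d' have "sat M (e(x := d)) p" by simp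
    then show "sat M e (FEx x p)" using mult_struc.dom[OF M] by auto
  qed
  then show ?case using finite_elim_var[OF S(1)] by blast
qed

text \<open>The convention \<open>ln 0 = 0\<close> supplies the prescribed logarithm of
  zero.\<close>

lemma mult_struc_realS: "mult_struc realS sgn (\<lambda>x. ln \<bar>x\<bar>) (1::real)"
proof
  fix s l :: real assume "s = 1 \<or> s = -1"
  then show "\<exists>x. sgn x = s \<and> ln \<bar>x\<bar> = l"
    by (intro exI[of _ "s * exp l"]) (auto simp: sgn_mult abs_mult)
next
  fix x y :: real
  assume "sgn x = sgn y" "sgn x \<noteq> 0 \<Longrightarrow> ln \<bar>x\<bar> = ln \<bar>y\<bar>"
  then show "x = y" by (auto simp: sgn_if split: if_splits)
next
  fix x y :: real
  show "lessf realS x y \<longleftrightarrow> sgn x < sgn y \<or>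
      sgn x = sgn y \<and> (sgn x = 1 \<and> ln \<bar>x\<bar> < ln \<bar>y\<bar> \<or> sgn x = -1 \<and> ln \<bar>y\<bar> < ln \<bar>x\<bar>)"
    by (auto simp: realS_def sgn_if)
next
  fix x :: real
  show "sgn x = 1 \<or> sgn x = 0 \<or> sgn x = -1" by (simp add: sgn_if)
qed (auto simp: realS_def sgn_mult sgn_eq_0_iff abs_mult ln_mult ln_div sgn_divide)

lemma sat_T_mult:
  assumes M: "mult_struc M sg lg u" and p: "p \<in> T_mult F"
  shows "sat M e p"
proof -
  obtain S where S: "\<And>e e'. \<forall>i. sg (e i) = sgn (e' i) \<Longrightarrow>
    agree S u (\<lambda>i. lg (e i)) 1 (\<lambda>i. ln \<bar>e' i\<bar>) \<Longrightarrow> sat M e p = sat realS e' p"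
    using mult_struc_agree[OF M mult_struc_realS] p by (force simp: T_mult_def)
  have "agree S u (\<lambda>i. lg (zer M)) 1 (\<lambda>i. ln \<bar>0 :: real\<bar>)"
    using mult_struc.u[OF M]
    by (auto simp: agree_def fval_zero mult_struc.zero[OF M] zero_less_scaleR_iff scaleR_less_zero_iff)
  then have "sat M (\<lambda>_. zer M) p"
    using S[of "\<lambda>_. zer M" "\<lambda>_. 0"] p by (simp add: T_mult_def mult_struc.zero[OF M])
  moreover have "sat M (\<lambda>_. zer M) p = sat M e p"
    using p by (intro sat_cong) (simp add: T_mult_def sentence_def)
  ultimately show ?thesis by simp
qed

section \<open>Structures with a common order and scalar multiplication\<close>

definition sgv :: "'v::{zero,linorder} \<Rightarrow> real" where
  "sgv x = (if 0 < x then 1 else if x < 0 then -1 else 0)"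

definition absv :: "'v::{zero,linorder,uminus} \<Rightarrow> 'v" where
  "absv x = (if x < 0 then - x else x)"

text \<open>The value 0 at 0 is the convention required by \<open>mult_struc\<close>.\<close>

definition lam :: "('l \<Rightarrow> 'v) \<Rightarrow> 'v::{zero,linorder,uminus} \<Rightarrow> 'l::zero" where
  "lam E x = (if x = 0 then 0 else inv E (absv x))"

text \<open>An exponential \<open>E\<close> transports the addition of its domain to a multiplication of the
  positive elements of its codomain; equivariance makes multiplication by \<open>r *\<^sub>R E 0\<close>
  agree with scalar multiplication.\<close>

definition exp_like :: "'l::{ordered_real_vector,linordered_ab_group_add} \<Rightarrow>
    'v::{ordered_real_vector,linordered_ab_group_add} \<Rightarrow> ('l \<Rightarrow> 'v) \<Rightarrow> bool" where
  "exp_like u one E \<longleftrightarrow> strict_mono E \<and> range E = {x. 0 < x} \<and>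
     (\<forall>l r. E (l + r *\<^sub>R u) = exp r *\<^sub>R E l) \<and> E 0 = one"

text \<open>If a factor is 0, the product of signs kills the result whatever \<open>lam\<close>
  gives; the same formula yields 0 for division by 0.\<close>

definition exp_struc :: "('l::{ordered_real_vector,linordered_ab_group_add} \<Rightarrow>
    'v::{ordered_real_vector,linordered_ab_group_add}) \<Rightarrow> 'v struc" where
  "exp_struc E = \<lparr>dom = UNIV, zer = 0, onef = E 0, addf = (+), subf = (-),
     mulf = (\<lambda>x y. (sgv x * sgv y) *\<^sub>R E (lam E x + lam E y)),
     divf = (\<lambda>x y. (sgv x * sgv y) *\<^sub>R E (lam E x - lam E y)),
     scf = (*\<^sub>R), lessf = (<)\<rparr>"

lemma sgv_eq_0_iff [simp]: "sgv x = 0 \<longleftrightarrow> x = 0" for x :: "'v::{zero,linorder}"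
  by (auto simp: sgv_def)

lemma sgv_scaleR:
  "sgv (a *\<^sub>R x) = sgn a * sgv x" for x :: "'v::{ordered_real_vector,linordered_ab_group_add}"
  by (auto simp: sgv_def zero_less_scaleR_iff scaleR_less_zero_iff sgn_if)

lemma sgv_cases: "x \<noteq> 0 \<Longrightarrow> sgv x = 1 \<or> sgv x = -1" for x :: "'v::{zero,linorder}"
  by (auto simp: sgv_def)

lemma absv_pos: "x \<noteq> 0 \<Longrightarrow> 0 < absv x" for x :: "'v::linordered_ab_group_add"
  by (auto simp: absv_def)

lemma sgv_absv: "x = sgv x *\<^sub>R absv x" for x :: "'v::{ordered_real_vector,linordered_ab_group_add}"
  by (auto simp: sgv_def absv_def)

lemma absv_sgv: "absv x = sgv x *\<^sub>R x" for x :: "'v::{ordered_real_vector,linordered_ab_group_add}"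
  by (auto simp: sgv_def absv_def)

lemma absv_scaleR:
  "absv (a *\<^sub>R x) = \<bar>a\<bar> *\<^sub>R absv x" for x :: "'v::{ordered_real_vector,linordered_ab_group_add}"
  by (auto simp: absv_def zero_less_scaleR_iff scaleR_less_zero_iff abs_if not_less_iff_gr_or_eq)

lemma sgn_sgv: "sgn (sgv x) = sgv x" for x :: "'v::{zero,linorder}"
  by (simp add: sgv_def)

context
  fixes u :: "'l::{ordered_real_vector,linordered_ab_group_add}"
    and one :: "'v::{ordered_real_vector,linordered_ab_group_add}" and E
  assumes E: "exp_like u one E"
begin

lemma E_inj: "inj E"
  using E by (auto simp: exp_like_def intro: strict_mono_imp_inj_on)

lemma E_pos: "0 < E l"
  using E by (auto simp: exp_like_def)

lemma E_less_iff: "E l < E l' \<longleftrightarrow> l < l'"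
  using E by (auto simp: exp_like_def strict_mono_less)

lemma E_add: "E (l + r *\<^sub>R u) = exp r *\<^sub>R E l"
  using E by (simp add: exp_like_def)

lemma E_0: "E 0 = one"
  using E by (simp add: exp_like_def)

lemma E_lam: "x \<noteq> 0 \<Longrightarrow> E (lam E x) = absv x"
  using E absv_pos[of x] by (auto simp: exp_like_def lam_def f_inv_into_f)

lemma lam_eqI: "x \<noteq> 0 \<Longrightarrow> E l = absv x \<Longrightarrow> lam E x = l"
  using E_lam[of x] injD[OF E_inj] by metis

lemma sgv_E_lam: "sgv x *\<^sub>R E (lam E x) = x"
  using E_lam[of x] sgv_absv[of x] by (cases "x = 0") auto

lemma lam_one: "lam E one = 0"
  using E_pos[of 0] by (intro lam_eqI) (auto simp: E_0 absv_def)

lemma lam_sgv_E: "s = 1 \<or> s = -1 \<Longrightarrow> lam E (s *\<^sub>R E l) = l"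
  using E_pos[of l] by (intro lam_eqI) (auto simp: absv_def)

lemma sgv_sgv_E: "s = 1 \<or> s = -1 \<Longrightarrow> sgv (s *\<^sub>R E l) = s"
  using E_pos[of l] by (auto simp: sgv_def)

lemma lam_scaleR:
  assumes "a \<noteq> 0" "x \<noteq> 0"
  shows "lam E (a *\<^sub>R x) = ln \<bar>a\<bar> *\<^sub>R u + lam E x"
  using assms by (intro lam_eqI) (auto simp: absv_scaleR E_add E_lam add.commute[of _ "lam E x"])

text \<open>Moving along \<open>u\<close> multiplies the positive \<open>E 0\<close> by
  \<open>exp 1\<close>, and \<open>E\<close> reflects the order.\<close>

lemma unit_pos: "0 < u"
proof -
  have "E 0 < exp 1 *\<^sub>R E 0"
    using E_pos[of 0] zero_less_scaleR_iff[of "exp 1 - 1" "E 0"] by (simp add: scaleR_diff_left)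
  also have "\<dots> = E (0 + 1 *\<^sub>R u)" by (simp only: E_add)
  finally show ?thesis by (simp add: E_less_iff)
qed

lemma sgv_E: "sgv (E l) = 1"
  using E_pos[of l] by (simp add: sgv_def)

lemma lam_mult_sgv_E:
  assumes "x \<noteq> 0" "y \<noteq> 0"
  shows "lam E ((sgv x * sgv y) *\<^sub>R E l) = l"
proof -
  have "sgv x * sgv y = 1 \<or> sgv x * sgv y = -1"
    using sgv_cases[of x] sgv_cases[of y] assms by auto
  then show ?thesis by (rule lam_sgv_E)
qed

lemma mult_struc_exp_struc: "mult_struc (exp_struc E) sgv (lam E) u"
proof
  show "0 < u" by (rule unit_pos)
next
  fix x y :: 'v
  assume "sgv x = sgv y" "sgv x \<noteq> 0 \<Longrightarrow> lam E x = lam E y"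
  then show "x = y" using sgv_E_lam[of x] sgv_E_lam[of y] by (metis scaleR_zero_left)
next
  fix s l assume "s = (1::real) \<or> s = -1"
  then show "\<exists>x. sgv x = s \<and> lam E x = l"
    using lam_sgv_E sgv_sgv_E by blast
next
  fix x y :: 'v
  have lt: "lam E x < lam E y \<longleftrightarrow> absv x < absv y" if "x \<noteq> 0" "y \<noteq> 0" for x y :: 'v
    using that by (simp flip: E_less_iff add: E_lam)
  show "lessf (exp_struc E) x y \<longleftrightarrow> sgv x < sgv y \<or>
      sgv x = sgv y \<and> (sgv x = 1 \<and> lam E x < lam E y \<or> sgv x = -1 \<and> lam E y < lam E x)"
  proof (cases "x = 0 \<or> y = 0")
    case True
    then show ?thesis by (auto simp: exp_struc_def sgv_def)
  next
    case False
    then have ne: "x \<noteq> 0" "y \<noteq> 0" by auto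
    show ?thesis using ne
      by (cases x "0::'v" rule: linorder_cases; cases y "0::'v" rule: linorder_cases)
        (auto simp: exp_struc_def lt sgv_def absv_def dest: less_trans)
  qed
next
  fix x :: 'v
  show "sgv x = 1 \<or> sgv x = 0 \<or> sgv x = -1" by (auto simp: sgv_def)
qed (auto simp: exp_struc_def sgv_scaleR sgn_sgv sgv_E sgn_mult lam_scaleR lam_mult_sgv_E lam_one E_0
    sgv_E[of 0, unfolded E_0] lam_def[of E 0])

lemma add_struc_exp_struc: "add_struc (exp_struc E)"
  using E_pos by (simp add: add_struc_def exp_struc_def)

end

section \<open>Lexicographic vector spaces and their exponential\<close>

instantiation poly_mapping :: (type, real_vector) real_vector
begin

lift_definition scaleR_poly_mapping :: "real \<Rightarrow> ('a \<Rightarrow>\<^sub>0 'b) \<Rightarrow> ('a \<Rightarrow>\<^sub>0 'b)"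
  is "\<lambda>r f k. r *\<^sub>R f k"
  by (rule rev_finite_subset) auto

instance
  by standard (transfer; simp add: fun_eq_iff scaleR_add_right scaleR_add_left)+

end

abbreviation lookup where "lookup \<equiv> Poly_Mapping.lookup"

lemma lookup_scaleR [simp]: "lookup (r *\<^sub>R f) k = r *\<^sub>R lookup f k"
  by transfer simp

text \<open>Small keys dominate: a vector supported on keys above \<open>m\<close> is infinitesimal
  against any vector with a nonzero entry at some key up to \<open>m\<close>.\<close>

lemma poly_mapping_less_iff:
  "f < g \<longleftrightarrow> (\<exists>k. lookup f k < lookup g k \<and> (\<forall>j<k. lookup f j = lookup g j))"
  by transfer (simp add: less_fun_def)

instance poly_mapping :: (linorder, "{ordered_real_vector,linordered_ab_group_add}") ordered_real_vector
proof
  fix f g :: "'a \<Rightarrow>\<^sub>0 'b" and r s :: real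
  have pos: "0 < r *\<^sub>R f" if "0 < r" "0 < f" for r :: real and f :: "'a \<Rightarrow>\<^sub>0 'b"
    using that unfolding poly_mapping_less_iff by (auto simp: zero_less_scaleR_iff)
  show "f \<le> g \<Longrightarrow> 0 \<le> r \<Longrightarrow> r *\<^sub>R f \<le> r *\<^sub>R g"
    using pos[of r "g - f"] by (auto simp: le_less scaleR_diff_right)
  show "r \<le> s \<Longrightarrow> 0 \<le> f \<Longrightarrow> r *\<^sub>R f \<le> s *\<^sub>R f"
    using pos[of "s - r" f] by (auto simp: le_less scaleR_diff_left)
qed

instance prod :: (linordered_ab_group_add, linordered_ab_group_add) ordered_ab_group_add
  by standard (auto simp: less_eq_prod_def)

instance prod :: (linordered_ab_group_add, linordered_ab_group_add) linordered_ab_group_add ..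

instance prod :: ("{ordered_real_vector,linordered_ab_group_add}",
    "{ordered_real_vector,linordered_ab_group_add}") ordered_real_vector
proof
  fix f g :: "'a \<times> 'b" and r s :: real
  have pos: "0 < r *\<^sub>R f" if "0 < r" "0 < f" for r :: real and f :: "'a \<times> 'b"
    using that by (cases f) (auto simp: zero_prod_def zero_less_scaleR_iff)
  show "f \<le> g \<Longrightarrow> 0 \<le> r \<Longrightarrow> r *\<^sub>R f \<le> r *\<^sub>R g"
    using pos[of r "g - f"] by (auto simp: le_less scaleR_diff_right)
  show "r \<le> s \<Longrightarrow> 0 \<le> f \<Longrightarrow> r *\<^sub>R f \<le> s *\<^sub>R f"
    using pos[of "s - r" f] by (auto simp: le_less scaleR_diff_left)
qed

section \<open>Lexicographic vectors and their logarithms\<close>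

type_synonym vec = "real \<Rightarrow>\<^sub>0 real"
type_synonym logvec = "real \<times> real \<times> vec"

text \<open>Moves the entry at key \<open>j\<close> to key \<open>c + exp j\<close>, an order
  isomorphism from the reals onto the keys above \<open>c\<close>.\<close>

lift_definition rekey :: "real \<Rightarrow> vec \<Rightarrow> vec" is
  "\<lambda>c f k. if c < k then f (ln (k - c)) else 0"
proof -
  fix c :: real and f :: "real \<Rightarrow> real" assume fin: "finite {k. f k \<noteq> 0}"
  have "k \<in> (\<lambda>k. c + exp k) ` {k. f k \<noteq> 0}" if "c < k" "f (ln (k - c)) \<noteq> 0" for k
    using that by (intro image_eqI[of _ _ "ln (k - c)"]) auto
  then have "{k. (if c < k then f (ln (k - c)) else 0) \<noteq> 0} \<subseteq> (\<lambda>k. c + exp k) ` {k. f k \<noteq> 0}"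
    by (auto split: if_splits)
  then show "finite {k. (if c < k then f (ln (k - c)) else 0) \<noteq> 0}"
    using finite_surj[OF fin] by blast
qed

definition one_vec :: vec where "one_vec = Poly_Mapping.single 0 1"
definition log_unit :: logvec where "log_unit = (0, 1, 0)"

text \<open>A positive vector is determined by its least key \<open>- g\<close>, the coefficient
  \<open>exp b\<close> there, and the remainder relative to that coefficient, whose keys beyond
  \<open>- g\<close> are reparametrised by all the reals.\<close>

definition vec_exp :: "logvec \<Rightarrow> vec" where
  "vec_exp = (\<lambda>(g, b, w). exp b *\<^sub>R (Poly_Mapping.single (- g) 1 + rekey (- g) w))"

lemma lookup_vec_exp:
  "lookup (vec_exp (g, b, w)) k =
    (if k < - g then 0 else if k = - g then exp b else exp b * lookup w (ln (k + g)))"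
  by (simp add: vec_exp_def rekey.rep_eq lookup_add lookup_single when_def)

lemma strict_mono_vec_exp: "strict_mono vec_exp"
proof (rule strict_monoI)
  fix x y :: logvec
  assume less: "x < y"
  obtain g b w where x: "x = (g, b, w)" by (cases x) auto
  obtain g' b' w' where y: "y = (g', b', w')" by (cases y) auto
  consider "g < g'" | "g = g'" "b < b'" | "g = g'" "b = b'" "w < w'"
    using less by (auto simp: x y less_prod_def')
  then show "vec_exp x < vec_exp y"
  proof cases
    \<comment> \<open>A larger first coordinate moves the leading entry to a smaller key, hence the
      sign in \<open>- g\<close>; at key \<open>- g'\<close> only the larger vector has a nonzero
      entry.\<close>
    case 1
    then show ?thesis unfolding x y poly_mapping_less_iff
      by (intro exI[of _ "- g'"]) (simp add: lookup_vec_exp)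
  next
    case 2
    then show ?thesis unfolding x y poly_mapping_less_iff
      by (intro exI[of _ "- g"]) (simp add: lookup_vec_exp)
  next
    case 3
    then obtain k where k: "lookup w k < lookup w' k" "\<forall>j<k. lookup w j = lookup w' j"
      by (auto simp: poly_mapping_less_iff)
    \<comment> \<open>The witness \<open>exp k - g\<close> below is the key to which
      \<open>rekey (- g)\<close> moves \<open>k\<close>; the keys between \<open>- g\<close> and
      this witness come from keys below \<open>k\<close>.\<close>
    have "ln (j + g) < k" if "j < exp k - g" "- g < j" for j
    proof -
      have "ln (j + g) < ln (exp k)" using that by (subst ln_less_cancel_iff) auto
      then show ?thesis by simp
    qed
    then show ?thesis unfolding x y poly_mapping_less_iff
      using 3 k by (intro exI[of _ "exp k - g"]) (auto simp: lookup_vec_exp)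
  qed
qed

lemma range_vec_exp: "range vec_exp = {x. 0 < x}"
proof (intro set_eqI iffI)
  fix x assume "x \<in> range vec_exp"
  then obtain g b w where "x = vec_exp (g, b, w)" by auto
  then show "x \<in> {x. 0 < x}"
    unfolding mem_Collect_eq poly_mapping_less_iff
    by (intro exI[of _ "- g"]) (simp add: lookup_vec_exp)
next
  fix x :: vec assume "x \<in> {x. 0 < x}"
  then obtain k where k: "0 < lookup x k" "\<forall>j<k. lookup x j = 0"
    by (auto simp: poly_mapping_less_iff)
  \<comment> \<open>Undoes \<open>rekey\<close>: the entries beyond the leading key
    \<open>k\<close>, relative to the leading coefficient, are placed at the logarithm of their
    distance from \<open>k\<close>.\<close>
  define w where "w = (1 / lookup x k) *\<^sub>R Poly_Mapping.map_key (\<lambda>j. k + exp j) x"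
  have "inj (\<lambda>j. k + exp j)" by (auto intro: injI)
  then have "lookup w j = lookup x (k + exp j) / lookup x k" for j
    by (simp add: w_def map_key.rep_eq)
  then have "x = vec_exp (- k, ln (lookup x k), w)"
    using k by (intro poly_mapping_eqI) (auto simp: lookup_vec_exp not_less_iff_gr_or_eq)
  then show "x \<in> range vec_exp" by blast
qed

lemma exp_like_vec_exp: "exp_like log_unit one_vec vec_exp"
proof -
  have "rekey 0 0 = 0" by transfer (simp add: fun_eq_iff)
  then have "vec_exp 0 = one_vec"
    by (simp add: vec_exp_def one_vec_def zero_prod_def)
  moreover have "vec_exp (l + r *\<^sub>R log_unit) = exp r *\<^sub>R vec_exp l" for l r
    by (cases l) (simp add: vec_exp_def log_unit_def exp_add mult.commute)
  ultimately show ?thesis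
    by (simp add: exp_like_def strict_mono_vec_exp range_vec_exp)
qed

section \<open>Generic perturbation of an exponential\<close>

text \<open>Inside a coset of \<open>J\<close> the map is a translation. Between cosets it preserves
  the order because, by convexity, adding an element of \<open>J\<close> cannot reverse the sign of
  an element outside \<open>J\<close>. A preimage of \<open>y\<close> is \<open>y - s y\<close>,
  which lies in the same coset.\<close>

lemma coset_shift:
  fixes s :: "'a \<Rightarrow> 'a::{ordered_real_vector,linordered_ab_group_add}"
  assumes J: "subspace J" and conv: "\<And>x j. 0 < x \<Longrightarrow> x \<notin> J \<Longrightarrow> j \<in> J \<Longrightarrow> 0 < x + j"
    and s: "\<And>y. s y \<in> J" "\<And>y y'. y' - y \<in> J \<Longrightarrow> s y' = s y"
  shows "strict_mono (\<lambda>y. y + s y)" "surj (\<lambda>y. y + s y)"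
proof -
  show "strict_mono (\<lambda>y. y + s y)"
  proof (rule strict_monoI)
    fix x y :: 'a assume less: "x < y"
    show "x + s x < y + s y"
    proof (cases "y - x \<in> J")
      case True
      then show ?thesis using s(2)[of y x] less by simp
    next
      case False
      have "0 < (y - x) + (s y - s x)"
        using less s(1) by (intro conv False) (auto intro: subspace_diff[OF J])
      then show ?thesis by (simp add: algebra_simps)
    qed
  qed
  have "y = (y - s y) + s (y - s y)" for y
    using s(2)[of y "y - s y"] s(1)[of y] by simp
  then show "surj (\<lambda>y. y + s y)" by (metis surjI)
qed

section \<open>Infinitesimal tails and bounded heads\<close>

definition tail :: "real \<Rightarrow> vec set" where
  "tail m = {w. \<forall>k\<le>m. lookup w k = 0}"

definition head :: "real \<Rightarrow> vec set" where
  "head m = {w. \<forall>k>m. lookup w k = 0}"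

lemma subspace_tail: "subspace (tail m)"
  by (auto simp: subspace_def tail_def lookup_add)

lemma subspace_head: "subspace (head m)"
  by (auto simp: subspace_def head_def lookup_add)

lemma head_tail: "w \<in> head m \<Longrightarrow> w \<in> tail m \<Longrightarrow> w = 0"
  by (intro poly_mapping_eqI) (auto simp: head_def tail_def, metis not_le)

text \<open>The leading key of \<open>x\<close> is at most \<open>m\<close>, and there
  \<open>j\<close> has no entry.\<close>

lemma tail_convex:
  assumes "0 < x" "x \<notin> tail m" "j \<in> tail m"
  shows "0 < x + j"
proof -
  obtain k where k: "0 < lookup x k" "\<forall>i<k. lookup x i = 0"
    using assms(1) by (auto simp: poly_mapping_less_iff)
  have "k \<le> m" using assms(2) k(2) by (force simp: tail_def)
  then show ?thesis unfolding poly_mapping_less_iff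
    using k assms(3) by (intro exI[of _ k]) (auto simp: lookup_add tail_def)
qed

text \<open>Finite supports enter here: finitely many vectors have a common bound for their keys,
  and beyond it there is free room.\<close>

lemma finite_subset_head:
  assumes "finite W"
  shows "\<exists>m. W \<subseteq> head m"
proof -
  have fin: "finite (\<Union>w\<in>W. Poly_Mapping.keys w)" using assms by simp
  obtain m where "\<forall>k\<in>(\<Union>w\<in>W. Poly_Mapping.keys w). k \<le> m"
    using bdd_above_finite[OF fin] by (auto simp: bdd_above_def)
  then show ?thesis by (intro exI[of _ m]) (force simp: head_def in_keys_iff)
qed

definition eps :: "real \<Rightarrow> vec" where "eps m = Poly_Mapping.single (m + 1) 1"

lemma eps_tail: "eps m \<in> tail m"
  by (auto simp: eps_def tail_def lookup_single when_def)

lemma eps_pos: "0 < eps m"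
  unfolding poly_mapping_less_iff
  by (intro exI[of _ "m + 1"]) (auto simp: eps_def lookup_single when_def)

lemma eps_head: "v \<in> head m \<Longrightarrow> v + r *\<^sub>R eps m \<in> head m \<Longrightarrow> r = 0"
  by (auto simp: eps_def head_def lookup_single lookup_add when_def split: if_splits dest!: spec[of _ "m + 1"])

text \<open>Supplies values for new variables: the head containing \<open>B\<close> is a subspace
  that misses \<open>eps m\<close>.\<close>

lemma exists_pos_not_in_span: "finite B \<Longrightarrow> \<exists>y::vec. 0 < y \<and> y \<notin> span B"
proof -
  assume "finite B"
  then obtain m where "B \<subseteq> head m" using finite_subset_head by blast
  then have "span B \<subseteq> head m" by (intro span_minimal subspace_head)
  moreover have "eps m \<notin> head m"
    using eps_head[of 0 m 1] subspace_0[OF subspace_head] by auto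
  ultimately show ?thesis using eps_pos by blast
qed

text \<open>Shifting by a vector whose single key lies beyond all keys in sight affects only one coset
  of a convex subspace, which misses \<open>D\<close>, and leaves every span of vectors in sight.\<close>

lemma perturb_log:
  fixes E :: "logvec \<Rightarrow> vec"
  assumes E: "exp_like log_unit one_vec E" and fin: "finite D" "finite B"
    and D: "0 \<notin> D" "one_vec \<in> D" and c: "c \<noteq> 0" "\<And>x r. x \<in> D \<Longrightarrow> x \<noteq> r *\<^sub>R c"
  shows "\<exists>E'. exp_like log_unit one_vec E' \<and> (\<forall>x\<in>D. lam E' x = lam E x) \<and> lam E' c \<notin> span B"
proof -
  define l0 where "l0 = lam E c"
  define rest :: "logvec \<Rightarrow> vec" where "rest = (\<lambda>l. snd (snd l))"
  obtain m where m: "rest ` (insert l0 (lam E ` D \<union> B)) \<subseteq> head m"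
    using finite_subset_head fin by (metis finite_Un finite_imageI finite_insert)
  define J where "J = {0::real} \<times> {0::real} \<times> tail m"
  define \<epsilon> :: logvec where "\<epsilon> = (0, 0, eps m)"
  \<comment> \<open>Equivariance forces the shift on the \<open>J\<close>-coset of \<open>l0\<close>
    to be repeated on all its translates along \<open>log_unit\<close>.\<close>
  define Z where "Z = {l. \<exists>r. l - l0 - r *\<^sub>R log_unit \<in> J}"
  \<comment> \<open>The sign makes \<open>l0 + \<epsilon>\<close> the preimage of \<open>l0\<close>
    under the shift, so the new logarithm of \<open>c\<close> becomes
    \<open>l0 + \<epsilon>\<close>.\<close>
  define s where "s = (\<lambda>l. if l \<in> Z then - \<epsilon> else 0)"
  have J: "subspace J"
    unfolding J_def by (intro subspace_Times subspace_tail subspace_single_0)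
  have \<epsilon>: "\<epsilon> \<in> J" by (simp add: \<epsilon>_def J_def eps_tail)
  have conv: "0 < x + j" if "0 < x" "x \<notin> J" "j \<in> J" for x j
    using that tail_convex[of "rest x" m "rest j"]
    by (cases x; cases j) (auto simp: J_def rest_def zero_prod_def)
  have Z_shift: "l + j \<in> Z \<longleftrightarrow> l \<in> Z" if "j \<in> J" for l j
  proof -
    have "l + j - l0 - r *\<^sub>R log_unit \<in> J \<longleftrightarrow> l - l0 - r *\<^sub>R log_unit \<in> J" for r
      using subspace_add[OF J _ that, of "l - l0 - r *\<^sub>R log_unit"]
        subspace_diff[OF J _ that, of "l + j - l0 - r *\<^sub>R log_unit"]
      by (auto simp: algebra_simps)
    then show ?thesis by (simp add: Z_def)
  qed
  have s: "s l \<in> J" "l' - l \<in> J \<Longrightarrow> s l' = s l" for l l'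
    using \<epsilon> subspace_neg[OF J] subspace_0[OF J] Z_shift[of "l' - l" l] by (auto simp: s_def)
  define h where "h = (\<lambda>l. l + s l)"
  have h: "strict_mono h" "surj h"
    unfolding h_def using coset_shift[OF J conv s] by auto
  have Z_unit: "l + r *\<^sub>R log_unit \<in> Z \<longleftrightarrow> l \<in> Z" for l r
  proof
    assume "l \<in> Z"
    then obtain q where "l - l0 - q *\<^sub>R log_unit \<in> J" by (auto simp: Z_def)
    then have "l + r *\<^sub>R log_unit - l0 - (q + r) *\<^sub>R log_unit \<in> J" by (simp add: algebra_simps)
    then show "l + r *\<^sub>R log_unit \<in> Z" unfolding Z_def by blast
  next
    assume "l + r *\<^sub>R log_unit \<in> Z"
    then obtain q where "l + r *\<^sub>R log_unit - l0 - q *\<^sub>R log_unit \<in> J" by (auto simp: Z_def)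
    then have "l - l0 - (q - r) *\<^sub>R log_unit \<in> J" by (simp add: algebra_simps)
    then show "l \<in> Z" unfolding Z_def by blast
  qed
  have h_unit: "h (l + r *\<^sub>R log_unit) = h l + r *\<^sub>R log_unit" for l r
    by (simp add: h_def s_def Z_unit)
  \<comment> \<open>Such a logarithm would be \<open>l0\<close> plus a multiple of
    \<open>log_unit\<close> plus an element of \<open>J\<close>. Both remainders have their keys up
    to \<open>m\<close>, so the element of \<open>J\<close> vanishes and \<open>x\<close> would be a
    real multiple of \<open>c\<close>.\<close>
  have D_Z: "lam E x \<notin> Z" if x: "x \<in> D" for x
  proof
    assume "lam E x \<in> Z"
    then obtain r where r: "lam E x - l0 - r *\<^sub>R log_unit \<in> J" by (auto simp: Z_def)
    have "rest (lam E x) \<in> head m" "rest l0 \<in> head m" using m x by auto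
    then have "rest (lam E x) - rest l0 \<in> head m" by (rule subspace_diff[OF subspace_head])
    moreover have "rest (lam E x) - rest l0 \<in> tail m"
      using r by (auto simp: J_def rest_def log_unit_def mem_Times_iff)
    ultimately have "rest (lam E x) - rest l0 = 0" by (rule head_tail)
    then have "lam E x = l0 + r *\<^sub>R log_unit"
      using r by (auto simp: J_def rest_def log_unit_def prod_eq_iff mem_Times_iff)
    then have "absv x = exp r *\<^sub>R absv c"
      using E_lam[OF E, of x] E_lam[OF E, of c] E_add[OF E, of l0 r] x D c(1) l0_def by metis
    then have "sgv x *\<^sub>R absv x = (sgv x * exp r * sgv c) *\<^sub>R c"
      by (simp only: absv_sgv[of c] scaleR_scaleR mult.assoc)
    then have "x = (sgv x * exp r * sgv c) *\<^sub>R c" by (simp flip: sgv_absv)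
    then show False using c(2)[OF x] by blast
  qed
  define E' where "E' = E \<circ> h"
  \<comment> \<open>0 is the logarithm of \<open>one_vec\<close>, which belongs to \<open>D\<close>
    precisely so that the value at 0 stays fixed.\<close>
  have "0 \<notin> Z" using D_Z[OF D(2)] lam_one[OF E] by simp
  then have "E' 0 = one_vec" using E by (simp add: E'_def h_def s_def exp_like_def)
  moreover have "range E' = {x. 0 < x}"
  proof -
    have "range E' = E ` range h" unfolding E'_def image_comp ..
    then show ?thesis using E h(2) by (simp add: exp_like_def)
  qed
  ultimately have E': "exp_like log_unit one_vec E'"
    using E h(1) strict_mono_o[of E h] by (simp add: exp_like_def E'_def h_unit del: split_paired_All)
  moreover have "lam E' x = lam E x" if "x \<in> D" for x
  proof -
    have "x \<noteq> 0" using that D(1) by auto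
    then show ?thesis using D_Z[OF that]
      by (intro lam_eqI[OF E']) (auto simp: E'_def h_def s_def E_lam[OF E])
  qed
  moreover have "lam E' c \<notin> span B"
  proof -
    have "l0 \<in> Z" using subspace_0[OF J] by (auto simp: Z_def intro!: exI[of _ 0])
    then have "l0 + \<epsilon> \<in> Z" using Z_shift[OF \<epsilon>] by blast
    then have "E' (l0 + \<epsilon>) = absv c" by (simp add: E'_def h_def s_def l0_def E_lam[OF E c(1)])
    then have "lam E' c = l0 + \<epsilon>" by (rule lam_eqI[OF E' c(1)])
    moreover have "span B \<subseteq> UNIV \<times> UNIV \<times> head m"
      using m by (intro span_minimal subspace_Times subspace_UNIV subspace_head)
        (force simp: rest_def mem_Times_iff)
    moreover have "rest l0 \<in> head m" using m by auto
    then have "rest l0 + eps m \<notin> head m" using eps_head[of "rest l0" m 1] by auto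
    then have "l0 + \<epsilon> \<notin> UNIV \<times> UNIV \<times> head m"
      by (auto simp: \<epsilon>_def rest_def mem_Times_iff)
    ultimately show ?thesis by auto
  qed
  ultimately show ?thesis by blast
qed

text \<open>Values are shifted here instead of logarithms, so the shift has to commute with real
  multiples: it is \<open>r *\<^sub>R eps m\<close> on the coset of \<open>r *\<^sub>R c\<close>, in
  particular 0 on \<open>J\<close> itself.\<close>

lemma perturb_exp:
  fixes E :: "logvec \<Rightarrow> vec"
  assumes E: "exp_like log_unit one_vec E" and fin: "finite D" "finite B"
    and D: "0 \<notin> D" "one_vec \<in> D" and c: "\<And>x r. x \<in> D \<Longrightarrow> x \<noteq> r *\<^sub>R E l0"
  shows "\<exists>E'. exp_like log_unit one_vec E' \<and> (\<forall>x\<in>D. lam E' x = lam E x) \<and> E' l0 \<notin> span B"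
proof -
  define c where "c = E l0"
  have c_pos: "0 < c" using E_pos[OF E] by (simp add: c_def)
  obtain m where m: "insert c (D \<union> B) \<subseteq> head m"
    using finite_subset_head fin by (metis finite_Un finite_insert)
  define J where "J = tail m"
  have J: "subspace J" by (simp add: J_def subspace_tail)
  have "c \<notin> J" using m head_tail[of c m] c_pos by (auto simp: J_def)
  \<comment> \<open>As \<open>c\<close> lies outside the tail, a coset contains at most one multiple
    of \<open>c\<close>, so the shift is well defined.\<close>
  have uniq: "r = r'" if "y - r *\<^sub>R c \<in> J" "y - r' *\<^sub>R c \<in> J" for y r r'
  proof (rule ccontr)
    assume "r \<noteq> r'"
    have "(r' - r) *\<^sub>R c \<in> J"
      using subspace_diff[OF J that] by (simp add: scaleR_diff_left)
    then have "(1 / (r' - r)) *\<^sub>R (r' - r) *\<^sub>R c \<in> J" by (rule subspace_scale[OF J])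
    then show False using \<open>r \<noteq> r'\<close> \<open>c \<notin> J\<close> by simp
  qed
  define s where "s = (\<lambda>y. if \<exists>r. y - r *\<^sub>R c \<in> J then (SOME r. y - r *\<^sub>R c \<in> J) *\<^sub>R eps m else 0)"
  have s_eq: "s y = r *\<^sub>R eps m" if "y - r *\<^sub>R c \<in> J" for y r
    using that someI[of "\<lambda>r. y - r *\<^sub>R c \<in> J" r] uniq by (auto simp: s_def)
  have s_0: "s y = 0" if "\<And>r. y - r *\<^sub>R c \<notin> J" for y
    using that by (auto simp: s_def)
  have s: "s y \<in> J" "y' - y \<in> J \<Longrightarrow> s y' = s y" for y y'
  proof -
    show "s y \<in> J"
      by (auto simp: s_def J_def intro: subspace_scale[OF subspace_tail] eps_tail subspace_0[OF subspace_tail])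
    assume d: "y' - y \<in> J"
    have iff: "y' - r *\<^sub>R c \<in> J \<longleftrightarrow> y - r *\<^sub>R c \<in> J" for r
      using subspace_add[OF J _ d, of "y - r *\<^sub>R c"] subspace_diff[OF J _ d, of "y' - r *\<^sub>R c"]
      by auto
    then show "s y' = s y" by (simp add: s_def)
  qed
  define h where "h = (\<lambda>y. y + s y)"
  have h: "strict_mono h" "surj h"
    unfolding h_def using coset_shift[OF J _ s] tail_convex by (auto simp: J_def)
  have h_scale: "h (a *\<^sub>R y) = a *\<^sub>R h y" if "a \<noteq> 0" for a y
  proof (cases "\<exists>r. y - r *\<^sub>R c \<in> J")
    case True
    then obtain r where r: "y - r *\<^sub>R c \<in> J" by blast
    have "a *\<^sub>R y - (a * r) *\<^sub>R c \<in> J"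
      using subspace_scale[OF J r, of a] by (simp add: scaleR_diff_right)
    then show ?thesis using s_eq[OF r] s_eq by (simp add: h_def scaleR_add_right)
  next
    case False
    have "a *\<^sub>R y - r *\<^sub>R c \<notin> J" for r
    proof
      assume "a *\<^sub>R y - r *\<^sub>R c \<in> J"
      from subspace_scale[OF J this, of "1 / a"] have "y - (r / a) *\<^sub>R c \<in> J"
        using that by (simp add: scaleR_diff_right)
      then show False using False by blast
    qed
    then show ?thesis using False by (simp add: h_def s_0)
  qed
  have "h 0 = 0" using s_eq[of 0 0] subspace_0[OF J] by (simp add: h_def)
  then have h_pos: "0 < h y \<longleftrightarrow> 0 < y" for y
    using h(1) by (metis strict_mono_less)
  then have h_image: "h ` {y. 0 < y} = {y. 0 < y}"
    using h(2) by (auto simp: image_iff) (metis surjD)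
  \<comment> \<open>Vectors of \<open>D\<close> and \<open>c\<close> lie in \<open>head m\<close>,
    so sharing a coset with a multiple of \<open>c\<close> would mean being that multiple.\<close>
  have h_D: "h (absv x) = absv x" if x: "x \<in> D" for x
  proof -
    have "absv x - r *\<^sub>R c \<notin> J" for r
    proof
      assume "absv x - r *\<^sub>R c \<in> J"
      moreover have "absv x - r *\<^sub>R c \<in> head m"
        using m x by (auto simp: absv_def intro!: subspace_diff[OF subspace_head]
            subspace_scale[OF subspace_head] subspace_neg[OF subspace_head])
      ultimately have "absv x = r *\<^sub>R c"
        using head_tail[of "absv x - r *\<^sub>R c"] by (auto simp: J_def)
      then have "x = (sgv x * r) *\<^sub>R E l0"
        using sgv_absv[of x] by (simp add: c_def)
      then show False using c[OF x] by blast
    qed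
    then show ?thesis by (simp add: h_def s_0)
  qed
  define E' where "E' = h \<circ> E"
  have "absv one_vec = one_vec" using E_pos[OF E, of 0] by (auto simp: E_0[OF E] absv_def)
  then have "E' 0 = one_vec" using h_D[OF D(2)] by (simp add: E'_def E_0[OF E])
  moreover have "range E' = {x. 0 < x}"
  proof -
    have "range E' = h ` range E" unfolding E'_def image_comp ..
    then show ?thesis using E by (simp add: exp_like_def h_image)
  qed
  ultimately have E': "exp_like log_unit one_vec E'"
    using E h(1) strict_mono_o[of h E] by (simp add: exp_like_def E'_def h_scale del: split_paired_All)
  moreover have "lam E' x = lam E x" if "x \<in> D" for x
  proof -
    have "x \<noteq> 0" using that D(1) by auto
    then show ?thesis using h_D[OF that]
      by (intro lam_eqI[OF E']) (auto simp: E'_def E_lam[OF E])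
  qed
  moreover have "E' l0 \<notin> span B"
  proof -
    have "s c = eps m" using s_eq[of c 1] subspace_0[OF J] by simp
    then have "E' l0 = c + 1 *\<^sub>R eps m" by (simp add: E'_def h_def c_def)
    moreover have "span B \<subseteq> head m" using m by (intro span_minimal subspace_head) auto
    ultimately show ?thesis using eps_head[of c m 1] m by auto
  qed
  ultimately show ?thesis by blast
qed

section \<open>Cardinality of the lexicographic space\<close>

lemma exists_inj_vec_real: "\<exists>f :: vec \<Rightarrow> real. inj f"
proof -
  \<comment> \<open>Encodes a vector by the Dedekind cuts of its partial sums over the keys below
    each rational: countably many bits, hence a real number.\<close>
  define cut where "cut = (\<lambda>v::vec. {(p::rat, q::rat).
    real_of_rat q < (\<Sum>k\<in>{k \<in> Poly_Mapping.keys v. k < real_of_rat p}. lookup v k)})"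
  have "inj cut"
  proof (rule injI, rule ccontr)
    fix v w assume eq: "cut v = cut w" and "v \<noteq> w"
    define K where "K = Poly_Mapping.keys v \<union> Poly_Mapping.keys w"
    have part: "(\<Sum>k\<in>{k \<in> Poly_Mapping.keys x. k < p}. lookup x k) = (\<Sum>k\<in>{k \<in> K. k < p}. lookup x k)"
      if "x = v \<or> x = w" for x p
    proof -
      have "finite {k \<in> K. k < p}" by (simp add: K_def)
      then show ?thesis
        using that by (intro sum.mono_neutral_left) (auto simp: K_def in_keys_iff)
    qed
    have sums: "(\<Sum>k\<in>{k \<in> K. k < real_of_rat p}. lookup v k) = (\<Sum>k\<in>{k \<in> K. k < real_of_rat p}. lookup w k)"
      (is "?A = ?B") for p
    proof (rule ccontr)
      assume "?A \<noteq> ?B"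
      then have "min ?A ?B < max ?A ?B" by (auto simp: min_def max_def)
      then obtain q where "min ?A ?B < real_of_rat q" "real_of_rat q < max ?A ?B"
        using of_rat_dense by blast
      then have "(real_of_rat q < ?A) \<noteq> (real_of_rat q < ?B)"
        by (auto simp: min_less_iff_disj less_max_iff_disj)
      moreover have "(p, q) \<in> cut v \<longleftrightarrow> (p, q) \<in> cut w" using eq by simp
      ultimately show False by (simp add: cut_def part)
    qed
    obtain k where k: "k \<in> K" "lookup v k \<noteq> lookup w k"
      using \<open>v \<noteq> w\<close> by (metis K_def UnI1 UnI2 in_keys_iff poly_mapping_eqI)
    define A where "A = {k \<in> K. lookup v k \<noteq> lookup w k}"
    have A: "finite A" "A \<noteq> {}" using k by (auto simp: A_def K_def)
    define a where "a = Min A"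
    have a: "a \<in> A" "\<And>k. k \<in> A \<Longrightarrow> a \<le> k" using A by (auto simp: a_def)
    define C where "C = {k \<in> K. a < k}"
    have "\<exists>b. a < b \<and> (\<forall>k\<in>C. b \<le> k)"
    proof (cases "C = {}")
      case True
      then show ?thesis by (auto intro: exI[of _ "a + 1"])
    next
      case False
      have "finite C" by (simp add: C_def K_def)
      then show ?thesis using False by (intro exI[of _ "Min C"]) (auto simp: C_def)
    qed
    then obtain b where b: "a < b" "\<And>k. k \<in> C \<Longrightarrow> b \<le> k" by blast
    \<comment> \<open>No key lies strictly between \<open>a\<close>, the least key where the vectors
      differ, and \<open>b\<close>. Below \<open>a\<close> the entries agree, so the partial sums up
      to \<open>p\<close> isolate the entry at \<open>a\<close>.\<close>
    obtain p where p: "a < real_of_rat p" "real_of_rat p < b" using of_rat_dense[OF b(1)] by blast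
    have "{k \<in> K. k < real_of_rat p} = insert a {k \<in> K. k < a}"
      using a(1) p b(2) by (force simp: A_def C_def)
    moreover have "(\<Sum>k\<in>{k \<in> K. k < a}. lookup v k) = (\<Sum>k\<in>{k \<in> K. k < a}. lookup w k)"
      using a(2) by (intro sum.cong) (force simp: A_def)+
    moreover have "finite {k \<in> K. k < a}" by (simp add: K_def)
    ultimately have "lookup v a = lookup w a" using sums[of p] by simp
    then show False using a(1) by (simp add: A_def)
  qed
  moreover obtain g :: "rat \<times> rat \<Rightarrow> nat" where "inj g" by blast
  then have "inj (\<lambda>S. g ` S)" by (metis injI inj_image_eq_iff)
  moreover obtain r :: "nat set \<Rightarrow> real" where "inj r"
    using nat_sets_eqpoll_reals by (auto simp: eqpoll_def bij_betw_def)
  ultimately have "inj (r \<circ> (\<lambda>S. g ` S) \<circ> cut)" by (intro inj_compose)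
  then show ?thesis by blast
qed

section \<open>The order on normal forms\<close>

definition strict_order_on :: "'a set \<Rightarrow> ('a \<Rightarrow> 'a \<Rightarrow> bool) \<Rightarrow> bool" where
  "strict_order_on D R \<longleftrightarrow> (\<forall>x\<in>D. \<not> R x x) \<and>
     (\<forall>x\<in>D. \<forall>y\<in>D. \<forall>z\<in>D. R x y \<longrightarrow> R y z \<longrightarrow> R x z) \<and>
     (\<forall>x\<in>D. \<forall>y\<in>D. x \<noteq> y \<longrightarrow> R x y \<or> R y x)"

lemma strict_order_onD:
  assumes "strict_order_on D R"
  shows "x \<in> D \<Longrightarrow> \<not> R x x"
    and "x \<in> D \<Longrightarrow> y \<in> D \<Longrightarrow> z \<in> D \<Longrightarrow> R x y \<Longrightarrow> R y z \<Longrightarrow> R x z"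
    and "x \<in> D \<Longrightarrow> y \<in> D \<Longrightarrow> x \<noteq> y \<Longrightarrow> R x y \<or> R y x"
  using assms unfolding strict_order_on_def by blast+

lemma strict_order_on_subset: "strict_order_on D R \<Longrightarrow> D' \<subseteq> D \<Longrightarrow> strict_order_on D' R"
  unfolding strict_order_on_def by (meson subsetD)

lemma strict_order_on_cong:
  assumes "\<And>x y. x \<in> D \<Longrightarrow> y \<in> D \<Longrightarrow> R x y = Q x y"
  shows "strict_order_on D R = strict_order_on D Q"
  unfolding strict_order_on_def using assms by (simp cong: ball_cong)

text \<open>\<open>R u v\<close> makes \<open>v\<close> more significant than \<open>u\<close>: the
  decisive position is the \<open>R\<close>-greatest one at which the functions differ.\<close>

definition lexless :: "'a set \<Rightarrow> ('a \<Rightarrow> 'a \<Rightarrow> bool) \<Rightarrow> ('a \<Rightarrow> 'b::linorder) \<Rightarrow> ('a \<Rightarrow> 'b) \<Rightarrow> bool" where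
  "lexless D R f g \<longleftrightarrow> (\<exists>u\<in>D. f u < g u \<and> (\<forall>v\<in>D. R u v \<longrightarrow> f v = g v))"

lemma lexless_trans:
  assumes D: "strict_order_on D R" and "lexless D R f g" "lexless D R g h"
  shows "lexless D R f h"
proof -
  obtain u where u: "u \<in> D" "f u < g u" "\<And>v. v \<in> D \<Longrightarrow> R u v \<Longrightarrow> f v = g v"
    using assms(2) by (auto simp: lexless_def)
  obtain w where w: "w \<in> D" "g w < h w" "\<And>v. v \<in> D \<Longrightarrow> R w v \<Longrightarrow> g v = h v"
    using assms(3) by (auto simp: lexless_def)
  consider "u = w" | "R u w" | "R w u" using strict_order_onD(3)[OF D u(1) w(1)] by blast
  then show ?thesis
  proof cases
    case 1
    then show ?thesis unfolding lexless_def
      using u w by (intro bexI[of _ u]) (auto intro: less_trans)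
  next
    case 2
    then show ?thesis unfolding lexless_def
      using u w strict_order_onD(2)[OF D u(1) w(1)] by (intro bexI[of _ w]) auto
  next
    case 3
    then show ?thesis unfolding lexless_def
      using u w strict_order_onD(2)[OF D w(1) u(1)] by (intro bexI[of _ u]) auto
  qed
qed

lemma exists_greatest:
  assumes "finite A" "A \<noteq> {}" "A \<subseteq> D" and D: "strict_order_on D R"
  shows "\<exists>u\<in>A. \<forall>v\<in>A. v = u \<or> R v u"
  using assms(1-3)
proof (induction A rule: finite_ne_induct)
  case (insert x A)
  then obtain u where u: "u \<in> A" "\<forall>v\<in>A. v = u \<or> R v u" by auto
  show ?case
  proof (cases "R u x")
    case True
    have "R v x" if "v \<in> A" for v
    proof -
      have "v \<in> D" "u \<in> D" "x \<in> D" using that u insert.prems by auto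
      then show ?thesis using u that True strict_order_onD(2)[OF D, of v u x] by (cases "v = u") auto
    qed
    then show ?thesis by blast
  next
    case False
    then have "x = u \<or> R x u"
      using u(1) insert.prems strict_order_onD(3)[OF D, of x u] by auto
    then show ?thesis using u by blast
  qed
qed auto

lemma lexless_total:
  assumes D: "strict_order_on D R" and fin: "finite {u \<in> D. f u \<noteq> g u}" and ne: "\<exists>u\<in>D. f u \<noteq> g u"
  shows "lexless D R f g \<or> lexless D R g f"
proof -
  obtain u where u: "u \<in> D" "f u \<noteq> g u" "\<And>v. v \<in> D \<Longrightarrow> f v \<noteq> g v \<Longrightarrow> v = u \<or> R v u"
    using exists_greatest[OF fin _ _ D] ne by auto
  then have "f v = g v" if "v \<in> D" "R u v" for v
    using that strict_order_onD(1,2)[OF D] by metis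
  then show ?thesis using u(1,2) unfolding lexless_def by (metis linorder_neqE)
qed

text \<open>The common reference \<open>z\<close> makes any two of the functions differ at finitely
  many positions, which totality needs.\<close>

lemma strict_order_on_lexless:
  assumes D: "strict_order_on D R"
    and P: "\<And>s t. s \<in> X \<Longrightarrow> t \<in> X \<Longrightarrow> P s t \<longleftrightarrow> lexless D R (f s) (f t)"
    and fin: "\<And>s. s \<in> X \<Longrightarrow> finite {u \<in> D. f s u \<noteq> z u}"
    and inj: "\<And>s t. s \<in> X \<Longrightarrow> t \<in> X \<Longrightarrow> (\<And>u. u \<in> D \<Longrightarrow> f s u = f t u) \<Longrightarrow> s = t"
  shows "strict_order_on X P"
  unfolding strict_order_on_def
proof (intro conjI ballI impI)
  fix s assume "s \<in> X"
  then show "\<not> P s s" using P by (auto simp: lexless_def)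
next
  fix s t r assume "s \<in> X" "t \<in> X" "r \<in> X" "P s t" "P t r"
  then show "P s r" using P lexless_trans[OF D] by metis
next
  fix s t assume st: "s \<in> X" "t \<in> X" "s \<noteq> t"
  have "finite {u \<in> D. f s u \<noteq> f t u}"
    using fin[OF st(1)] fin[OF st(2)] by (rule finite_subset[rotated, OF finite_UnI]) auto
  moreover have "\<exists>u\<in>D. f s u \<noteq> f t u" using inj st by blast
  ultimately show "P s t \<or> P t s" using lexless_total[OF D] P st by blast
qed

text \<open>Lets basic preterms, read as one-term sums, take part in the lexicographic comparison of
  sums.\<close>

lemma lexless_single:
  assumes D: "strict_order_on D R" and "s \<in> D" "t \<in> D"
  shows "lexless D R (\<lambda>u. if u = s then 1 else 0 :: 'b::linordered_idom) (\<lambda>u. if u = t then 1 else 0) \<longleftrightarrow> R s t"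
    (is "lexless D R ?f ?g \<longleftrightarrow> _")
proof
  assume "lexless D R ?f ?g"
  then obtain u where "?f u < ?g u" "\<forall>v\<in>D. R u v \<longrightarrow> ?f v = ?g v" unfolding lexless_def by blast
  then have "s \<noteq> t" "\<not> R t s" using assms by (auto split: if_splits)
  then show "R s t" using strict_order_onD(3)[OF assms] by blast
next
  assume "R s t"
  then have "s \<noteq> t" "\<not> R t s" "\<not> R t t"
    using strict_order_onD(1,2)[OF D] assms by blast+
  then show "lexless D R ?f ?g" unfolding lexless_def
    using assms by (intro bexI[of _ t]) auto
qed

subsection \<open>Association lists\<close>

definition asum :: "('c::comm_monoid_add \<times> 'b) list \<Rightarrow> 'b \<Rightarrow> 'c" where
  "asum l u = sum_list (map fst (filter (\<lambda>p. snd p = u) l))"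

lemma asum_Cons: "asum (p # l) u = (if snd p = u then fst p + asum l u else asum l u)"
  by (simp add: asum_def)

lemma asum_notin: "u \<notin> snd ` set l \<Longrightarrow> asum l u = 0"
  by (induction l) (auto simp: asum_Cons asum_def)

lemma asum_in: "distinct (map snd l) \<Longrightarrow> p \<in> set l \<Longrightarrow> asum l (snd p) = fst p"
  by (induction l) (auto simp: asum_Cons asum_notin image_iff)

lemma asum_eq_0_iff:
  assumes "distinct (map snd l)" "\<forall>p\<in>set l. fst p \<noteq> 0"
  shows "asum l u = 0 \<longleftrightarrow> u \<notin> snd ` set l"
  using assms asum_in[OF assms(1)] asum_notin[of u l] by auto

definition descending :: "('a \<Rightarrow> 'a \<Rightarrow> bool) \<Rightarrow> 'a list \<Rightarrow> bool" where
  "descending R xs \<longleftrightarrow> (\<forall>i. Suc i < length xs \<longrightarrow> R (xs ! Suc i) (xs ! i))"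

lemma descending_sorted_wrt:
  assumes "descending R xs" "set xs \<subseteq> D" "strict_order_on D R"
  shows "sorted_wrt (\<lambda>x y. R y x) xs"
proof -
  \<comment> \<open>Transitivity is known on \<open>D\<close> only, so the relation is cut down to
    \<open>D\<close> before adjacent comparisons are chained.\<close>
  have "transp (\<lambda>x y. x \<in> D \<and> y \<in> D \<and> R y x)"
    using strict_order_onD(2)[OF assms(3)] by (intro transpI) blast
  then have "sorted_wrt (\<lambda>x y. x \<in> D \<and> y \<in> D \<and> R y x) xs"
    using assms(1,2) by (auto simp: sorted_wrt_iff_nth_Suc_transp descending_def)
  then show ?thesis by (rule sorted_wrt_mono_rel[rotated]) auto
qed

lemma descending_distinct:
  assumes "descending R xs" "set xs \<subseteq> D" "strict_order_on D R"
  shows "distinct xs"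
  using descending_sorted_wrt[OF assms] assms(2) strict_order_onD(1)[OF assms(3)]
  by (induction xs) auto

lemma descending_unique:
  assumes D: "strict_order_on D R" and "descending R xs" "descending R ys" "set xs \<subseteq> D" "set xs = set ys"
  shows "xs = ys"
proof -
  have "sorted_wrt (\<lambda>x y. R y x) xs" "sorted_wrt (\<lambda>x y. R y x) ys"
    using descending_sorted_wrt[OF _ _ D] assms by auto
  moreover have "distinct xs" "distinct ys" using descending_distinct[OF _ _ D] assms by auto
  ultimately show ?thesis using assms(4,5)
  proof (induction xs arbitrary: ys)
    case (Cons x xs)
    then obtain y ys' where ys: "ys = y # ys'" by (cases ys) auto
    have "x = y"
    proof (rule ccontr)
      assume "x \<noteq> y"
      then have "R x y" "R y x" using Cons.prems by (auto simp: ys)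
      moreover have "x \<in> D" "y \<in> D" using Cons.prems by (auto simp: ys)
      ultimately show False using strict_order_onD(1)[OF D, of x] strict_order_onD(2)[OF D, of x y x] by blast
    qed
    moreover have "set xs = set ys'" using Cons.prems \<open>x = y\<close> by (auto simp: ys)
    moreover from this have "xs = ys'" using Cons.IH[of ys'] Cons.prems by (auto simp: ys)
    ultimately show ?case by (simp add: ys)
  qed auto
qed

text \<open>Coefficients being nonzero, the keys are exactly the support of \<open>asum\<close>, and
  a descending list is determined by its set of keys.\<close>

lemma assoc_list_eqI:
  assumes D: "strict_order_on D R" and desc: "descending R (map snd l)" "descending R (map snd l')"
    and sub: "snd ` set l \<subseteq> D" "snd ` set l' \<subseteq> D"
    and nz: "\<forall>p\<in>set l. fst p \<noteq> 0" "\<forall>p\<in>set l'. fst p \<noteq> 0"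
    and eq: "\<And>u. u \<in> D \<Longrightarrow> asum l u = asum l' u"
  shows "l = l'"
proof -
  have dist: "distinct (map snd l)" "distinct (map snd l')"
    using desc sub by (auto intro!: descending_distinct[OF _ _ D])
  have "snd ` set l = {u \<in> D. asum l u \<noteq> 0}" "snd ` set l' = {u \<in> D. asum l' u \<noteq> 0}"
    using sub asum_eq_0_iff[OF dist(1) nz(1)] asum_eq_0_iff[OF dist(2) nz(2)] by blast+
  then have "snd ` set l = snd ` set l'" using eq by auto
  then have snds: "map snd l = map snd l'"
    using sub by (intro descending_unique[OF D desc]) auto
  then have len: "length l = length l'" by (metis length_map)
  show ?thesis
  proof (rule nth_equalityI[OF len])
    fix i assume i: "i < length l"
    have s: "snd (l ! i) = snd (l' ! i)" using snds i len by (metis nth_map)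
    have "fst (l ! i) = asum l (snd (l ! i))" using asum_in[OF dist(1)] i by simp
    also have "snd (l' ! i) \<in> D" using sub(2) i len by auto
    then have "asum l (snd (l ! i)) = asum l' (snd (l' ! i))" using eq s by simp
    also have "\<dots> = fst (l' ! i)" using asum_in[OF dist(2)] i len by simp
    finally show "l ! i = l' ! i" using s by (simp add: prod_eq_iff)
  qed
qed

subsection \<open>Components of normal forms\<close>

definition acomps :: "pt \<Rightarrow> pt set" where "acomps s = snd ` set (addcomps s)"
definition mcomps :: "pt \<Rightarrow> pt set" where "mcomps s = fst ` set (mulcomps s)"

definition nonadd :: "real set \<Rightarrow> pt set" where "nonadd F = {p. nf F p \<and> \<not> is_add p}"
definition nonmul :: "real set \<Rightarrow> pt set" where "nonmul F = {p. nf F p \<and> \<not> is_mul p}"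

lemma acoef_asum: "acoef s = asum (addcomps s)"
  by (simp add: acoef_def asum_def fun_eq_iff)

lemma mexp_asum: "mexp s = asum (map prod.swap (mulcomps s))"
  by (simp add: mexp_def asum_def fun_eq_iff filter_map o_def)

lemma acoef_notin: "u \<notin> acomps s \<Longrightarrow> acoef s u = 0"
  by (simp add: acoef_asum acomps_def asum_notin)

lemma mexp_notin: "u \<notin> mcomps s \<Longrightarrow> mexp s u = 0"
  by (simp add: mexp_asum mcomps_def asum_notin image_image)

lemma finite_acomps: "finite (acomps s)" and finite_mcomps: "finite (mcomps s)"
  by (simp_all add: acomps_def mcomps_def)

lemma addcomps_nonadd: "\<not> is_add s \<Longrightarrow> addcomps s = [(1, s)]"
  by (cases s) auto

lemma mulcomps_nonmul: "\<not> is_mul s \<Longrightarrow> s \<noteq> POne \<Longrightarrow> mulcomps s = [(s, 1)]"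
  by (cases s) auto

lemma mexp_nonmul: "\<not> is_mul s \<Longrightarrow> s \<noteq> POne \<Longrightarrow> mexp s u = (if u = s then 1 else 0)"
  by (simp add: mexp_def mulcomps_nonmul)

lemma mexp_POne: "mexp POne u = 0"
  by (simp add: mexp_def)

lemma acomps_subset: "nf F s \<Longrightarrow> acomps s \<subseteq> nonadd F"
  by (cases s) (auto simp: acomps_def nonadd_def)

lemma mcomps_subset: "nf F s \<Longrightarrow> mcomps s \<subseteq> nonmul F - {POne}"
  by (cases s) (auto simp: mcomps_def nonmul_def)

lemma addcomps_nf:
  assumes "nf F s"
  shows "addcomps s \<noteq> []" "fst (hd (addcomps s)) = 1" "\<forall>p\<in>set (addcomps s). fst p \<noteq> 0"
    "descending prec (map snd (addcomps s))"
  using assms by (cases s; force simp: descending_def)+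

lemma mulcomps_nf:
  assumes "nf F s"
  shows "\<forall>p\<in>set (mulcomps s). snd p \<noteq> 0" "descending prec (map fst (mulcomps s))"
  using assms by (cases s; force simp: descending_def)+

lemma addcomps_inject: "nf F s \<Longrightarrow> nf F t \<Longrightarrow> addcomps s = addcomps t \<Longrightarrow> s = t"
  by (cases s; cases t) auto

lemma mulcomps_inject: "nf F s \<Longrightarrow> nf F t \<Longrightarrow> mulcomps s = mulcomps t \<Longrightarrow> s = t"
  by (cases s; cases t) auto

text \<open>Leading coefficients are normalised to 1, so proportional coefficient functions are
  equal; a factor 0 would erase the leading coefficient of \<open>s\<close>.\<close>

lemma nf_eqI_acoef:
  assumes D: "strict_order_on D prec" and nf: "nf F s" "nf F t"
    and sub: "acomps s \<subseteq> D" "acomps t \<subseteq> D"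
    and eq: "\<And>u. u \<in> D \<Longrightarrow> acoef s u = r * acoef t u"
  shows "s = t \<and> r = 1"
proof -
  define l where "l = map (\<lambda>p. (r * fst p, snd p)) (addcomps t)"
  have asum_l: "asum l u = r * acoef t u" for u
  proof -
    have "asum (map (\<lambda>p. (r * fst p, snd p)) xs) u = r * asum xs u" for xs :: "(real \<times> pt) list"
      by (induction xs) (auto simp: asum_Cons algebra_simps, auto simp: asum_def)
    then show ?thesis by (simp add: l_def acoef_asum)
  qed
  have snd_l: "map snd l = map snd (addcomps t)" "snd ` set l = acomps t"
    by (auto simp: l_def acomps_def image_image)
  have "r \<noteq> 0"
  proof
    assume "r = 0"
    have "distinct (map snd (addcomps s))"
      using sub(1) by (intro descending_distinct[OF addcomps_nf(4)[OF nf(1)] _ D]) (auto simp: acomps_def)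
    then have "acoef s (snd (hd (addcomps s))) = 1"
      using addcomps_nf(1,2)[OF nf(1)] asum_in[of "addcomps s" "hd (addcomps s)"]
      by (simp add: acoef_asum)
    moreover have "snd (hd (addcomps s)) \<in> D"
      using sub(1) addcomps_nf(1)[OF nf(1)] by (auto simp: acomps_def)
    ultimately show False using eq \<open>r = 0\<close> by auto
  qed
  then have "addcomps s = l"
    using addcomps_nf[OF nf(1)] addcomps_nf[OF nf(2)] snd_l sub eq
    by (intro assoc_list_eqI[OF D])
      (auto simp: asum_l simp flip: acoef_asum, auto simp: acomps_def l_def)
  then have "fst (hd (addcomps s)) = r * fst (hd (addcomps t))"
    using addcomps_nf(1)[OF nf(2)] by (simp add: l_def hd_map)
  then have "r = 1" using addcomps_nf(2)[OF nf(1)] addcomps_nf(2)[OF nf(2)] by simp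
  then have "addcomps s = addcomps t" using \<open>addcomps s = l\<close> by (simp add: l_def)
  then show ?thesis using addcomps_inject[OF nf] \<open>r = 1\<close> by blast
qed

lemma nf_eqI_mexp:
  assumes D: "strict_order_on D prec" and nf: "nf F s" "nf F t"
    and sub: "mcomps s \<subseteq> D" "mcomps t \<subseteq> D"
    and eq: "\<And>u. u \<in> D \<Longrightarrow> mexp s u = mexp t u"
  shows "s = t"
proof -
  have swap: "map snd (map prod.swap xs) = map fst xs" for xs :: "(pt \<times> int) list" by simp
  have "map prod.swap (mulcomps s) = map prod.swap (mulcomps t)"
    using mulcomps_nf[OF nf(1)] mulcomps_nf[OF nf(2)] sub eq
    by (intro assoc_list_eqI[OF D]; (unfold swap)?) (auto simp: mexp_asum mcomps_def image_image)
  moreover have "inj (prod.swap :: pt \<times> int \<Rightarrow> _)" by simp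
  ultimately have "mulcomps s = mulcomps t" by (metis inj_map_eq_map)
  then show ?thesis by (rule mulcomps_inject[OF nf])
qed

subsection \<open>Unfolding the recursion on ranks\<close>

lemma le_foldr_max: "x \<in> set xs \<Longrightarrow> f x \<le> foldr max (map f xs) (0::nat)"
  by (induction xs) auto

lemma odd_rank_PAdd: "odd (rank (PAdd l))" and even_rank_PMul: "even (rank (PMul m))"
  by (auto simp: odd_above_def even_above_def)

lemma rank_not_0: "rank (PAdd l) \<noteq> 0" "rank (PMul m) \<noteq> 0"
  by (auto simp: odd_above_def even_above_def)

lemma rank_component_less:
  "p \<in> set l \<Longrightarrow> rank (snd p) < rank (PAdd l)"
  "q \<in> set m \<Longrightarrow> rank (fst q) < rank (PMul m)"
  using le_foldr_max[of p l "\<lambda>p. rank (snd p)"] le_foldr_max[of q m "\<lambda>p. rank (fst p)"]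
  by (auto simp: odd_above_def even_above_def)

text \<open>A non-additive preterm is its own only component; there parity gives strictness, since
  its rank is even and \<open>n\<close> is odd.\<close>

lemma rank_acomps_less:
  assumes "odd n" "rank s \<le> n" "u \<in> acomps s" shows "rank u < n"
proof (cases s)
  case (PAdd l)
  then show ?thesis using assms rank_component_less(1)[of _ l] by (fastforce simp: acomps_def)
next
  case (PMul l)
  then show ?thesis using assms even_rank_PMul[of l]
    by (auto simp: acomps_def le_less simp del: rank.simps)
qed (use assms in \<open>auto simp: acomps_def intro: odd_pos\<close>)

lemma rank_mcomps_less:
  assumes "even n" "0 < n" "rank s \<le> n" "u \<in> mcomps s" shows "rank u < n"
proof (cases s)
  case (PMul l)
  then show ?thesis using assms rank_component_less(2)[of _ l] by (fastforce simp: mcomps_def)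
next
  case (PAdd l)
  then show ?thesis using assms odd_rank_PAdd[of l]
    by (auto simp: mcomps_def le_less simp del: rank.simps)
qed (use assms in \<open>auto simp: mcomps_def\<close>)

text \<open>One round of the recursion with the comparison of components as a parameter, so that
  \<open>precf k\<close> and \<open>prec\<close> can be exchanged under it.\<close>

definition add_lex :: "(pt \<Rightarrow> pt \<Rightarrow> bool) \<Rightarrow> pt \<Rightarrow> pt \<Rightarrow> bool" where
  "add_lex P s t \<longleftrightarrow> (\<exists>u\<in>acomps s \<union> acomps t. acoef s u < acoef t u \<and>
     (\<forall>v\<in>acomps s \<union> acomps t. P u v \<longrightarrow> acoef s v = acoef t v))"

definition mul_lex :: "(pt \<Rightarrow> pt \<Rightarrow> bool) \<Rightarrow> pt \<Rightarrow> pt \<Rightarrow> bool" where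
  "mul_lex P s t \<longleftrightarrow> (let U = mcomps s \<union> mcomps t in
     (\<exists>u\<in>U. P POne u \<and> mexp s u < mexp t u \<and> (\<forall>v\<in>U. P u v \<longrightarrow> mexp s v = mexp t v)) \<or>
     ((\<forall>u\<in>U. P POne u \<longrightarrow> mexp s u = mexp t u) \<and>
      (\<exists>u\<in>U. P u POne \<and> mexp t u < mexp s u \<and> (\<forall>v\<in>U. P v u \<longrightarrow> mexp s v = mexp t v))))"

lemma precf_Suc:
  "precf (Suc k) s t = (let n = max (rank s) (rank t) in
     if n = 0 then basic_less s t else if odd n then add_lex (precf k) s t else mul_lex (precf k) s t)"
  by (simp add: add_lex_def mul_lex_def acomps_def mcomps_def Let_def del: rank.simps)

lemma add_lex_cong:
  assumes "\<And>u v. u \<in> acomps s \<union> acomps t \<Longrightarrow> v \<in> acomps s \<union> acomps t \<Longrightarrow> P u v = Q u v"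
  shows "add_lex P s t = add_lex Q s t"
  unfolding add_lex_def using assms by (intro bex_cong refl conj_cong ball_cong) simp

lemma mul_lex_cong:
  assumes "\<And>u v. u \<in> insert POne (mcomps s \<union> mcomps t) \<Longrightarrow>
    v \<in> insert POne (mcomps s \<union> mcomps t) \<Longrightarrow> P u v = Q u v"
  shows "mul_lex P s t = mul_lex Q s t"
proof -
  define U where "U = mcomps s \<union> mcomps t"
  have eq: "\<And>u v. u \<in> U \<Longrightarrow> v \<in> U \<Longrightarrow> P u v = Q u v" "\<And>u. u \<in> U \<Longrightarrow> P POne u = Q POne u"
    "\<And>u. u \<in> U \<Longrightarrow> P u POne = Q u POne"
    using assms unfolding U_def by blast+
  show ?thesis
    unfolding mul_lex_def Let_def U_def[symmetric] by (simp add: eq cong: bex_cong ball_cong)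
qed

text \<open>Components have rank below the larger of the two ranks, so every sufficient recursion
  depth gives the same answer.\<close>

lemma precf_stable:
  "max (rank s) (rank t) \<le> k \<Longrightarrow> max (rank s) (rank t) \<le> k' \<Longrightarrow> precf k s t = precf k' s t"
proof (induction "max (rank s) (rank t)" arbitrary: s t k k' rule: less_induct)
  case less
  define n where "n = max (rank s) (rank t)"
  have le: "rank s \<le> n" "rank t \<le> n" by (simp_all add: n_def)
  show ?case
  proof (cases "n = 0")
    case True
    have "precf j s t = basic_less s t" for j
      using True by (cases j) (auto simp: n_def precf_Suc simp del: precf.simps(2))
    then show ?thesis by simp
  next
    case False
    obtain j j' where k: "k = Suc j" "k' = Suc j'"
      using less.prems False by (metis n_def le_zero_eq not0_implies_Suc)
    have IH: "precf j u v = precf j' u v" if "rank u < n" "rank v < n" for u v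
      using that less.prems by (intro less.hyps) (auto simp: n_def k)
    have "precf k s t = (if odd n then add_lex (precf j) s t else mul_lex (precf j) s t)"
      "precf k' s t = (if odd n then add_lex (precf j') s t else mul_lex (precf j') s t)"
      using False by (auto simp: k precf_Suc n_def Let_def simp del: precf.simps(2))
    moreover have "add_lex (precf j) s t = add_lex (precf j') s t" if "odd n"
      using rank_acomps_less[OF that le(1)] rank_acomps_less[OF that le(2)]
      by (intro add_lex_cong IH) blast+
    moreover have "mul_lex (precf j) s t = mul_lex (precf j') s t" if "even n"
      using rank_mcomps_less[OF that _ le(1)] rank_mcomps_less[OF that _ le(2)] False
      by (intro mul_lex_cong IH) auto
    ultimately show ?thesis by simp
  qed
qed

lemma prec_basic: "rank s = 0 \<Longrightarrow> rank t = 0 \<Longrightarrow> prec s t = basic_less s t"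
  by (simp add: prec_def)

lemma prec_rec:
  assumes n: "n = max (rank s) (rank t)" "n \<noteq> 0"
  shows "prec s t = (if odd n then add_lex prec s t else mul_lex prec s t)"
proof -
  have le: "rank s \<le> n" "rank t \<le> n" by (simp_all add: n(1))
  obtain k where k: "n = Suc k" using n(2) by (cases n) auto
  have stable: "precf k u v = prec u v" if "rank u < n" "rank v < n" for u v
    unfolding prec_def using that by (intro precf_stable) (auto simp: k)
  have "prec s t = precf (Suc k) s t" by (simp only: prec_def k flip: n(1))
  also have "\<dots> = (if odd n then add_lex (precf k) s t else mul_lex (precf k) s t)"
    using n by (auto simp: precf_Suc Let_def simp del: precf.simps(2))
  moreover have "add_lex (precf k) s t = add_lex prec s t" if "odd n"
    using rank_acomps_less[OF that le(1)] rank_acomps_less[OF that le(2)]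
    by (intro add_lex_cong stable) blast+
  moreover have "mul_lex (precf k) s t = mul_lex prec s t" if "even n"
    using rank_mcomps_less[OF that _ le(1)] rank_mcomps_less[OF that _ le(2)] n(2)
    by (intro mul_lex_cong stable) auto
  ultimately show ?thesis by simp
qed

text \<open>Outside the components both coefficients are 0, so the comparison can be read on one
  fixed domain \<open>D\<close> for all pairs.\<close>

lemma add_lex_lexless:
  assumes "acomps s \<union> acomps t \<subseteq> D"
  shows "add_lex P s t \<longleftrightarrow> lexless D P (acoef s) (acoef t)"
proof -
  have "u \<in> acomps s \<union> acomps t" if "acoef s u < acoef t u" for u
    using that acoef_notin[of u s] acoef_notin[of u t] by (cases "u \<in> acomps s \<union> acomps t") auto
  moreover have "acoef s v = acoef t v" if "v \<notin> acomps s \<union> acomps t" for v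
    using that by (simp add: acoef_notin)
  ultimately show ?thesis unfolding add_lex_def lexless_def using assms by blast
qed

text \<open>The comparison of exponents above \<open>1\<close> from the top and below \<open>1\<close>
  from the bottom is a single lexicographic comparison, for a rearranged order of significance and
  with negated exponents below \<open>1\<close>.\<close>

definition mul_sig :: "(pt \<Rightarrow> pt \<Rightarrow> bool) \<Rightarrow> pt \<Rightarrow> pt \<Rightarrow> bool" where
  "mul_sig P u v \<longleftrightarrow> (if P POne u then P POne v \<and> P u v else P POne v \<or> P v u)"

definition signed_exp :: "(pt \<Rightarrow> pt \<Rightarrow> bool) \<Rightarrow> pt \<Rightarrow> pt \<Rightarrow> int" where
  "signed_exp P s u = (if P POne u then mexp s u else - mexp s u)"

lemma strict_order_on_mul_sig:
  assumes D: "strict_order_on D P" "POne \<in> D"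
  shows "strict_order_on (D - {POne}) (mul_sig P)"
  unfolding strict_order_on_def mul_sig_def
  using strict_order_onD[OF D(1)] D(2) by (smt (verit, best) Diff_iff insertI1)

lemma mul_lex_lexless:
  assumes D: "strict_order_on D P" "POne \<in> D" and sub: "mcomps s \<union> mcomps t \<subseteq> D - {POne}"
  shows "mul_lex P s t \<longleftrightarrow> lexless (D - {POne}) (mul_sig P) (signed_exp P s) (signed_exp P t)"
    (is "_ \<longleftrightarrow> ?R")
proof -
  let ?U = "mcomps s \<union> mcomps t" and ?D = "D - {POne}"
  have out: "mexp s v = mexp t v" if "v \<notin> ?U" for v
    using that by (simp add: mexp_notin)
  \<comment> \<open>Recording that the exponents differ confines the quantifier to components, so
    \<open>?U\<close> may be replaced by the fixed domain \<open>?D\<close>.\<close>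
  have U: "(\<exists>u\<in>?U. mexp s u \<noteq> mexp t u \<and> Q u) \<longleftrightarrow> (\<exists>u\<in>?D. mexp s u \<noteq> mexp t u \<and> Q u)" for Q
    using sub out by blast
  have V: "(\<forall>v\<in>?U. Q v \<longrightarrow> mexp s v = mexp t v) \<longleftrightarrow> (\<forall>v\<in>?D. Q v \<longrightarrow> mexp s v = mexp t v)" for Q
    using sub out by blast
  have tri: "P POne u \<or> P u POne" "\<not> (P POne u \<and> P u POne)" if "u \<in> ?D" for u
    using that strict_order_onD[OF D(1)] D(2) by blast+
  have eq: "signed_exp P s v = signed_exp P t v \<longleftrightarrow> mexp s v = mexp t v" for v
    by (simp add: signed_exp_def)
  have up: "P POne v" if "P POne u" "P u v" "u \<in> ?D" "v \<in> ?D" for u v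
    using that strict_order_onD(2)[OF D(1)] D(2) by blast
  have "mul_lex P s t \<longleftrightarrow>
     (\<exists>u\<in>?U. mexp s u \<noteq> mexp t u \<and> P POne u \<and> mexp s u < mexp t u \<and>
        (\<forall>v\<in>?U. P u v \<longrightarrow> mexp s v = mexp t v)) \<or>
     ((\<forall>u\<in>?U. P POne u \<longrightarrow> mexp s u = mexp t u) \<and>
      (\<exists>u\<in>?U. mexp s u \<noteq> mexp t u \<and> P u POne \<and> mexp t u < mexp s u \<and>
        (\<forall>v\<in>?U. P v u \<longrightarrow> mexp s v = mexp t v)))"
    (is "_ \<longleftrightarrow> ?A \<or> _ \<and> ?B")
  proof -
    have "?A \<longleftrightarrow> (\<exists>u\<in>?U. P POne u \<and> mexp s u < mexp t u \<and> (\<forall>v\<in>?U. P u v \<longrightarrow> mexp s v = mexp t v))"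
      by (rule bex_cong) auto
    moreover have "?B \<longleftrightarrow> (\<exists>u\<in>?U. P u POne \<and> mexp t u < mexp s u \<and> (\<forall>v\<in>?U. P v u \<longrightarrow> mexp s v = mexp t v))"
      by (rule bex_cong) auto
    ultimately show ?thesis unfolding mul_lex_def Let_def by blast
  qed
  also have "\<dots> \<longleftrightarrow>
     (\<exists>u\<in>?D. mexp s u \<noteq> mexp t u \<and> P POne u \<and> mexp s u < mexp t u \<and>
        (\<forall>v\<in>?D. P u v \<longrightarrow> mexp s v = mexp t v)) \<or>
     ((\<forall>u\<in>?D. P POne u \<longrightarrow> mexp s u = mexp t u) \<and>
      (\<exists>u\<in>?D. mexp s u \<noteq> mexp t u \<and> P u POne \<and> mexp t u < mexp s u \<and>
        (\<forall>v\<in>?D. P v u \<longrightarrow> mexp s v = mexp t v)))"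
    by (simp only: U V)
  also have "\<dots> \<longleftrightarrow> ?R"
  proof
    assume ?R
    then obtain u where u: "u \<in> ?D" "signed_exp P s u < signed_exp P t u"
      "\<And>v. v \<in> ?D \<Longrightarrow> mul_sig P u v \<Longrightarrow> mexp s v = mexp t v"
      unfolding lexless_def eq by blast
    show "(\<exists>u\<in>?D. mexp s u \<noteq> mexp t u \<and> P POne u \<and> mexp s u < mexp t u \<and>
        (\<forall>v\<in>?D. P u v \<longrightarrow> mexp s v = mexp t v)) \<or>
     ((\<forall>u\<in>?D. P POne u \<longrightarrow> mexp s u = mexp t u) \<and>
      (\<exists>u\<in>?D. mexp s u \<noteq> mexp t u \<and> P u POne \<and> mexp t u < mexp s u \<and>
        (\<forall>v\<in>?D. P v u \<longrightarrow> mexp s v = mexp t v)))"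
    proof (cases "P POne u")
      case True
      then have "\<forall>v\<in>?D. P u v \<longrightarrow> mexp s v = mexp t v"
        using u(1,3) up by (auto simp: mul_sig_def)
      moreover have "mexp s u < mexp t u" using u(2) True by (simp add: signed_exp_def)
      ultimately show ?thesis using u(1) True by (intro disjI1 bexI[of _ u] conjI) auto
    next
      case False
      \<comment> \<open>Positions above 1 are all more significant than a decisive position below
        1.\<close>
      then have "\<forall>v\<in>?D. P POne v \<longrightarrow> mexp s v = mexp t v" "\<forall>v\<in>?D. P v u \<longrightarrow> mexp s v = mexp t v"
        using u(3) by (auto simp: mul_sig_def)
      moreover have "mexp t u < mexp s u" "P u POne"
        using u(2) False tri[OF u(1)] by (auto simp: signed_exp_def)
      ultimately show ?thesis using u(1) by (metis less_irrefl)
    qed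
  next
    assume "(\<exists>u\<in>?D. mexp s u \<noteq> mexp t u \<and> P POne u \<and> mexp s u < mexp t u \<and>
        (\<forall>v\<in>?D. P u v \<longrightarrow> mexp s v = mexp t v)) \<or>
     ((\<forall>u\<in>?D. P POne u \<longrightarrow> mexp s u = mexp t u) \<and>
      (\<exists>u\<in>?D. mexp s u \<noteq> mexp t u \<and> P u POne \<and> mexp t u < mexp s u \<and>
        (\<forall>v\<in>?D. P v u \<longrightarrow> mexp s v = mexp t v)))"
    then show ?R
    proof
      assume "\<exists>u\<in>?D. mexp s u \<noteq> mexp t u \<and> P POne u \<and> mexp s u < mexp t u \<and>
        (\<forall>v\<in>?D. P u v \<longrightarrow> mexp s v = mexp t v)"
      then show ?R unfolding lexless_def eq by (auto simp: signed_exp_def mul_sig_def)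
    next
      assume "(\<forall>u\<in>?D. P POne u \<longrightarrow> mexp s u = mexp t u) \<and>
        (\<exists>u\<in>?D. mexp s u \<noteq> mexp t u \<and> P u POne \<and> mexp t u < mexp s u \<and>
        (\<forall>v\<in>?D. P v u \<longrightarrow> mexp s v = mexp t v))"
      then obtain u where u: "\<forall>v\<in>?D. P POne v \<longrightarrow> mexp s v = mexp t v" "u \<in> ?D" "P u POne"
        "mexp t u < mexp s u" "\<forall>v\<in>?D. P v u \<longrightarrow> mexp s v = mexp t v" by blast
      then have "\<not> P POne u" using tri by blast
      then show ?R unfolding lexless_def eq
        using u by (intro bexI[of _ u]) (auto simp: signed_exp_def mul_sig_def)
    qed
  qed
  finally show ?thesis .
qed

section \<open>Linearity of the order by induction on rank\<close>

lemma rank_0_cases: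
  assumes "rank s = 0" obtains i where "s = PVar i" | "s = POne"
proof (cases s)
  case (PAdd l)
  then show ?thesis using assms rank_not_0(1)[of l] by simp
next
  case (PMul m)
  then show ?thesis using assms rank_not_0(2)[of m] by simp
qed (use that in auto)

lemma strict_order_on_basic: "strict_order_on {s. rank s = 0} prec"
proof -
  have "{s. rank s = 0} = insert POne (range PVar)" by (auto elim: rank_0_cases)
  moreover have "strict_order_on (insert POne (range PVar)) basic_less"
    unfolding strict_order_on_def by auto
  ultimately have "strict_order_on {s. rank s = 0} basic_less" by simp
  moreover have "strict_order_on {s. rank s = 0} prec = strict_order_on {s. rank s = 0} basic_less"
    by (rule strict_order_on_cong) (simp add: prec_basic)
  ultimately show ?thesis by simp
qed

lemma even_rank_nonadd: "s \<in> nonadd F \<Longrightarrow> even (rank s)"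
  using even_rank_PMul by (cases s) (auto simp: nonadd_def simp del: rank.simps(4))

lemma odd_rank_nonmul: "s \<in> nonmul F \<Longrightarrow> rank s = 0 \<or> odd (rank s)"
  using odd_rank_PAdd by (cases s) (auto simp: nonmul_def simp del: rank.simps(3))

text \<open>Two non-multiplicative preterms that are not both basic have an odd maximal rank, so
  \<open>prec\<close> takes the additive branch; basic ones are compared as one-term sums.\<close>

lemma prec_nonmul_lexless:
  assumes D: "strict_order_on {s \<in> nonadd F. rank s < n} prec" and n: "odd n"
    and s: "s \<in> nonmul F" "rank s \<le> n" and t: "t \<in> nonmul F" "rank t \<le> n"
  shows "prec s t \<longleftrightarrow> lexless {s \<in> nonadd F. rank s < n} prec (acoef s) (acoef t)"
    (is "_ \<longleftrightarrow> lexless ?D _ _ _")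
proof (cases "rank s = 0 \<and> rank t = 0")
  case True
  then have st: "s \<in> ?D" "t \<in> ?D" using n
    by (auto simp: nonadd_def intro: odd_pos elim!: rank_0_cases)
  then have "acoef s = (\<lambda>u. if u = s then 1 else 0)" "acoef t = (\<lambda>u. if u = t then 1 else 0)"
    by (auto simp: acoef_def addcomps_nonadd nonadd_def)
  then show ?thesis using lexless_single[OF D st, where 'b = real] by simp
next
  case False
  have "odd (max (rank s) (rank t))"
    using odd_rank_nonmul[OF s(1)] odd_rank_nonmul[OF t(1)] False by (auto simp: max_def)
  moreover from this have "max (rank s) (rank t) \<noteq> 0" by (metis even_zero)
  ultimately have "prec s t \<longleftrightarrow> add_lex prec s t" using prec_rec[OF refl, of s t] by metis
  moreover have "acomps s \<union> acomps t \<subseteq> ?D"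
    using rank_acomps_less[OF n] s t acomps_subset[of F] by (auto simp: nonmul_def)
  ultimately show ?thesis using add_lex_lexless by blast
qed

lemma prec_nonadd_lexless:
  assumes D: "strict_order_on {s \<in> nonmul F. rank s < n} prec" and n: "even n" "0 < n"
    and s: "s \<in> nonadd F" "rank s \<le> n" and t: "t \<in> nonadd F" "rank t \<le> n"
  shows "prec s t \<longleftrightarrow> lexless ({s \<in> nonmul F. rank s < n} - {POne}) (mul_sig prec)
    (signed_exp prec s) (signed_exp prec t)"
    (is "_ \<longleftrightarrow> lexless (?D - _) _ _ _")
proof -
  have one: "POne \<in> ?D" using n by (simp add: nonmul_def)
  have sub: "mcomps s \<union> mcomps t \<subseteq> ?D - {POne}"
    using rank_mcomps_less[OF n] s t mcomps_subset[of F] by (auto simp: nonadd_def)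
  note lex = mul_lex_lexless[OF D one sub]
  show ?thesis
  proof (cases "rank s = 0 \<and> rank t = 0")
    case True
    \<comment> \<open>Variables lie below 1 and have exponent 1 at themselves, so the reversed rule
      for positions below 1 reproduces the basic order.\<close>
    have "basic_less s t \<longleftrightarrow> mul_lex prec s t"
      using True
      by (auto elim!: rank_0_cases simp: mul_lex_def mcomps_def mexp_nonmul mexp_POne prec_basic
          split: if_splits)
    then show ?thesis using lex True by (simp add: prec_basic)
  next
    case False
    have "even (max (rank s) (rank t))"
      using even_rank_nonadd[OF s(1)] even_rank_nonadd[OF t(1)] by (auto simp: max_def)
    then have "prec s t \<longleftrightarrow> mul_lex prec s t" using False prec_rec[OF refl, of s t] by auto
    then show ?thesis using lex by simp
  qed
qed

text \<open>The two families feed each other: an odd rank adds only sums, compared through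
  non-additive components of smaller rank; an even rank adds only products, compared through
  non-multiplicative ones. A sum never has to be compared with a product.\<close>

lemma strict_order_on_rank:
  "strict_order_on {s \<in> nonadd F. rank s \<le> n} prec \<and> strict_order_on {s \<in> nonmul F. rank s \<le> n} prec"
proof (induction n)
  case 0
  show ?case by (auto intro: strict_order_on_subset[OF strict_order_on_basic])
next
  case (Suc n)
  have IH: "strict_order_on {s \<in> nonadd F. rank s < Suc n} prec"
    "strict_order_on {s \<in> nonmul F. rank s < Suc n} prec"
    using Suc by (auto simp: less_Suc_eq_le)
  show ?case
  proof (cases "odd (Suc n)")
    case True
    let ?D = "{s \<in> nonadd F. rank s < Suc n}"
    have "{s \<in> nonadd F. rank s \<le> Suc n} = {s \<in> nonadd F. rank s \<le> n}"
      using even_rank_nonadd[of _ F] True by (metis le_SucE le_SucI)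
    moreover have "strict_order_on {s \<in> nonmul F. rank s \<le> Suc n} prec"
    proof (rule strict_order_on_lexless[OF IH(1), where f = acoef and z = "\<lambda>_. 0"])
      fix s t assume st: "s \<in> {s \<in> nonmul F. rank s \<le> Suc n}" "t \<in> {s \<in> nonmul F. rank s \<le> Suc n}"
      show "prec s t \<longleftrightarrow> lexless ?D prec (acoef s) (acoef t)"
        using prec_nonmul_lexless[OF IH(1) True] st by blast
      show "finite {u \<in> ?D. acoef s u \<noteq> 0}"
        by (rule finite_subset[OF _ finite_acomps[of s]]) (auto intro: ccontr simp: acoef_notin)
      assume "\<And>u. u \<in> ?D \<Longrightarrow> acoef s u = acoef t u"
      then show "s = t"
        using nf_eqI_acoef[OF IH(1), of F s t 1] st rank_acomps_less[OF True] acomps_subset[of F]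
        by (auto simp: nonmul_def subset_eq)
    qed
    ultimately show ?thesis using Suc by simp
  next
    case False
    let ?D = "{s \<in> nonmul F. rank s < Suc n}"
    have ev: "even (Suc n)" using False by simp
    have one: "POne \<in> ?D" by (simp add: nonmul_def)
    have "{s \<in> nonmul F. rank s \<le> Suc n} = {s \<in> nonmul F. rank s \<le> n}"
      using odd_rank_nonmul[of _ F] ev by (metis le_SucE le_SucI nat.distinct(1))
    moreover have "strict_order_on {s \<in> nonadd F. rank s \<le> Suc n} prec"
    proof (rule strict_order_on_lexless[OF strict_order_on_mul_sig[OF IH(2) one],
          where f = "signed_exp prec" and z = "\<lambda>_. 0"])
      fix s t assume st: "s \<in> {s \<in> nonadd F. rank s \<le> Suc n}" "t \<in> {s \<in> nonadd F. rank s \<le> Suc n}"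
      show "prec s t \<longleftrightarrow> lexless (?D - {POne}) (mul_sig prec) (signed_exp prec s) (signed_exp prec t)"
        using prec_nonadd_lexless[OF IH(2) ev] st by blast
      show "finite {u \<in> ?D - {POne}. signed_exp prec s u \<noteq> 0}"
        by (rule finite_subset[OF _ finite_mcomps[of s]])
          (auto intro: ccontr simp: mexp_notin signed_exp_def split: if_splits)
      assume "\<And>u. u \<in> ?D - {POne} \<Longrightarrow> signed_exp prec s u = signed_exp prec t u"
      then have "mexp s u = mexp t u" if "u \<in> ?D - {POne}" for u
        using that by (fastforce simp: signed_exp_def split: if_splits)
      then show "s = t"
        using nf_eqI_mexp[OF strict_order_on_subset[OF IH(2), of "?D - {POne}"], of F s t] st
          rank_mcomps_less[OF ev] mcomps_subset[of F]
        by (auto simp: nonadd_def subset_eq)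
    qed
    ultimately show ?thesis using Suc by simp
  qed
qed

lemma strict_order_on_nonadd: "strict_order_on (nonadd F) prec"
  and strict_order_on_nonmul: "strict_order_on (nonmul F) prec"
proof -
  \<comment> \<open>Each axiom mentions at most three elements, and the sum of their ranks bounds
    all of them.\<close>
  have bound: "x \<in> {s \<in> A. rank s \<le> rank x + rank y + rank z}" "y \<in> {s \<in> A. rank s \<le> rank x + rank y + rank z}"
    "z \<in> {s \<in> A. rank s \<le> rank x + rank y + rank z}" if "x \<in> A" "y \<in> A" "z \<in> A" for x y z A
    using that by auto
  have "strict_order_on A prec" if A: "\<And>n. strict_order_on {s \<in> A. rank s \<le> n} prec" for A
    unfolding strict_order_on_def
    using strict_order_onD[OF A] bound[where A = A] by (meson)
  then show "strict_order_on (nonadd F) prec" "strict_order_on (nonmul F) prec"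
    using strict_order_on_rank by blast+
qed

section \<open>Values of normal forms\<close>

definition val :: "(logvec \<Rightarrow> vec) \<Rightarrow> (nat \<Rightarrow> vec) \<Rightarrow> pt \<Rightarrow> vec" where
  "val E e p = eval (exp_struc E) e (render p)"

abbreviation gen_exp :: "(logvec \<Rightarrow> vec) \<Rightarrow> bool" where
  "gen_exp \<equiv> exp_like log_unit one_vec"

text \<open>The additive map \<open>h\<close> is the identity for coefficients and the embedding of
  the integers for exponents.\<close>

lemma sum_list_asum:
  fixes f :: "'b \<Rightarrow> 'v::real_vector" and h :: "'c::comm_monoid_add \<Rightarrow> real"
  assumes "finite T" "snd ` set l \<subseteq> T" and h: "h 0 = 0" "\<And>x y. h (x + y) = h x + h y"
  shows "(\<Sum>p\<leftarrow>l. h (fst p) *\<^sub>R f (snd p)) = (\<Sum>u\<in>T. h (asum l u) *\<^sub>R f u)"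
  using assms(2)
proof (induction l)
  case Nil
  then show ?case by (simp add: asum_def h)
next
  case (Cons p l)
  have "h (asum (p # l) u) *\<^sub>R f u
      = (if u = snd p then h (fst p) *\<^sub>R f u else 0) + h (asum l u) *\<^sub>R f u" for u
    by (simp add: asum_Cons h scaleR_add_left)
  then show ?case using Cons assms(1) by (simp add: sum.distrib)
qed

lemma val_simps [simp]:
  "val E e (PVar i) = e i"
  "val E e POne = E 0"
  by (simp_all add: val_def exp_struc_def)

lemma val_PAdd: "val E e (PAdd l) = (\<Sum>p\<leftarrow>l. fst p *\<^sub>R val E e (snd p))"
proof -
  have "eval (exp_struc E) e (foldl (\<lambda>acc q. Add acc (Sc (fst q) (render (snd q)))) t l)
    = eval (exp_struc E) e t + (\<Sum>p\<leftarrow>l. fst p *\<^sub>R val E e (snd p))" for t l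
    by (induction l arbitrary: t) (auto simp: exp_struc_def val_def add.assoc)
  then show ?thesis by (cases l) (auto simp: val_def exp_struc_def)
qed

lemma val_addcomps: "val E e p = (\<Sum>q\<leftarrow>addcomps p. fst q *\<^sub>R val E e (snd q))"
  by (cases p) (auto simp: val_PAdd)

lemma val_acoef:
  "finite T \<Longrightarrow> acomps p \<subseteq> T \<Longrightarrow> val E e p = (\<Sum>u\<in>T. acoef p u *\<^sub>R val E e u)"
  using sum_list_asum[of T "addcomps p" "\<lambda>x. x" "val E e"]
  by (simp add: acomps_def acoef_asum flip: val_addcomps)

context
  fixes E assumes E: "gen_exp E"
begin

interpretation mult_struc "exp_struc E" sgv "lam E" log_unit
  by (rule mult_struc_exp_struc[OF E])

lemma eval_iprod:
  assumes "eval (exp_struc E) e t \<noteq> 0" "0 < n"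
  shows "sgv (eval (exp_struc E) e (iprod t n)) = sgv (eval (exp_struc E) e t) ^ n \<and>
    lam E (eval (exp_struc E) e (iprod t n)) = real n *\<^sub>R lam E (eval (exp_struc E) e t)"
  using assms
proof (induction t n rule: iprod.induct)
  case (3 t n)
  then have IH: "sgv (eval (exp_struc E) e (iprod t (Suc n))) = sgv (eval (exp_struc E) e t) ^ Suc n"
    "lam E (eval (exp_struc E) e (iprod t (Suc n))) = real (Suc n) *\<^sub>R lam E (eval (exp_struc E) e t)"
    by auto
  then have "sgv (eval (exp_struc E) e (iprod t (Suc n))) \<noteq> 0"
    using 3(2) by (metis power_not_zero sgv_eq_0_iff)
  then show ?case using 3(2) IH
    by (simp add: sg_mul lg_mul algebra_simps scaleR_2)
qed auto

lemma eval_ipow: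
  assumes "eval (exp_struc E) e t \<noteq> 0" "i \<noteq> 0"
  shows "sgv (eval (exp_struc E) e (ipow t i)) = sgv (eval (exp_struc E) e t) ^ nat \<bar>i\<bar>"
    and "lam E (eval (exp_struc E) e (ipow t i)) = real_of_int i *\<^sub>R lam E (eval (exp_struc E) e t)"
proof -
  note pos = eval_iprod[OF assms(1), of "nat i"] and neg = eval_iprod[OF assms(1), of "nat (- i)"]
  have "sgv (eval (exp_struc E) e (iprod t (nat (- i)))) \<noteq> 0" if "i < 0"
    using neg that assms(1) by auto
  then show "sgv (eval (exp_struc E) e (ipow t i)) = sgv (eval (exp_struc E) e t) ^ nat \<bar>i\<bar>"
    and "lam E (eval (exp_struc E) e (ipow t i)) = real_of_int i *\<^sub>R lam E (eval (exp_struc E) e t)"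
    using pos neg assms(2) by (auto simp: ipow_def sg_div lg_div one)
qed

lemma val_PMul:
  assumes "\<forall>q\<in>set l. val E e (fst q) \<noteq> 0 \<and> snd q \<noteq> 0"
  shows "sgv (val E e (PMul l)) = (\<Prod>q\<leftarrow>l. sgv (val E e (fst q)) ^ nat \<bar>snd q\<bar>)"
    and "lam E (val E e (PMul l)) = (\<Sum>q\<leftarrow>l. real_of_int (snd q) *\<^sub>R lam E (val E e (fst q)))"
proof -
  have fold: "sgv (eval (exp_struc E) e (foldl (\<lambda>acc q. Mul acc (ipow (render (fst q)) (snd q))) t l))
      = sgv (eval (exp_struc E) e t) * (\<Prod>q\<leftarrow>l. sgv (val E e (fst q)) ^ nat \<bar>snd q\<bar>) \<and>
    lam E (eval (exp_struc E) e (foldl (\<lambda>acc q. Mul acc (ipow (render (fst q)) (snd q))) t l))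
      = lam E (eval (exp_struc E) e t) + (\<Sum>q\<leftarrow>l. real_of_int (snd q) *\<^sub>R lam E (val E e (fst q)))"
    if "sgv (eval (exp_struc E) e t) \<noteq> 0" "\<forall>q\<in>set l. val E e (fst q) \<noteq> 0 \<and> snd q \<noteq> 0" for t l
    using that
  proof (induction l arbitrary: t)
    case (Cons q l)
    define t' where "t' = Mul t (ipow (render (fst q)) (snd q))"
    have q: "eval (exp_struc E) e (render (fst q)) \<noteq> 0" "snd q \<noteq> 0"
      using Cons.prems by (auto simp: val_def)
    note pow = eval_ipow[OF q]
    have "sgv (eval (exp_struc E) e (ipow (render (fst q)) (snd q))) \<noteq> 0"
      using pow(1) q(1) by simp
    then have t': "sgv (eval (exp_struc E) e t') =
        sgv (eval (exp_struc E) e t) * sgv (val E e (fst q)) ^ nat \<bar>snd q\<bar>"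
      "lam E (eval (exp_struc E) e t') =
        lam E (eval (exp_struc E) e t) + real_of_int (snd q) *\<^sub>R lam E (val E e (fst q))"
      "sgv (eval (exp_struc E) e t') \<noteq> 0"
      using pow Cons.prems(1) by (simp_all add: t'_def sg_mul lg_mul val_def)
    show ?case using Cons.IH[OF t'(3)] Cons.prems(2) t'(1,2) by (simp add: t'_def add.assoc mult.assoc)
  qed auto
  have "sgv (val E e (PMul l)) = (\<Prod>q\<leftarrow>l. sgv (val E e (fst q)) ^ nat \<bar>snd q\<bar>) \<and>
    lam E (val E e (PMul l)) = (\<Sum>q\<leftarrow>l. real_of_int (snd q) *\<^sub>R lam E (val E e (fst q)))"
  proof (cases l)
    case Nil
    then show ?thesis using one by (simp add: val_def)
  next
    case (Cons q l')
    have q: "eval (exp_struc E) e (render (fst q)) \<noteq> 0" "snd q \<noteq> 0"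
      using assms by (auto simp: val_def Cons)
    note pow = eval_ipow[OF q]
    have "sgv (eval (exp_struc E) e (ipow (render (fst q)) (snd q))) \<noteq> 0"
      using pow(1) q(1) by simp
    from fold[OF this, of l'] show ?thesis using pow assms by (simp add: val_def Cons)
  qed
  then show "sgv (val E e (PMul l)) = (\<Prod>q\<leftarrow>l. sgv (val E e (fst q)) ^ nat \<bar>snd q\<bar>)"
    and "lam E (val E e (PMul l)) = (\<Sum>q\<leftarrow>l. real_of_int (snd q) *\<^sub>R lam E (val E e (fst q)))"
    by blast+
qed

lemma lam_val_mulcomps:
  assumes "nf F p" "\<forall>u\<in>mcomps p. val E e u \<noteq> 0"
  shows "lam E (val E e p) = (\<Sum>q\<leftarrow>mulcomps p. real_of_int (snd q) *\<^sub>R lam E (val E e (fst q)))"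
proof (cases p)
  case (PMul l)
  then show ?thesis using assms by (auto simp: mcomps_def intro!: val_PMul)
qed (auto simp: one E_0[OF E] lam_one[OF E])

lemma lam_val_mexp:
  assumes "nf F p" "\<forall>u\<in>mcomps p. val E e u \<noteq> 0" "finite T" "mcomps p \<subseteq> T"
  shows "lam E (val E e p) = (\<Sum>u\<in>T. real_of_int (mexp p u) *\<^sub>R lam E (val E e u))"
  using sum_list_asum[of T "map prod.swap (mulcomps p)" real_of_int "\<lambda>u. lam E (val E e u)"] assms
  by (simp add: lam_val_mulcomps mexp_asum mcomps_def image_image o_def)

lemma val_PMul_nonzero:
  assumes "\<forall>q\<in>set l. val E e (fst q) \<noteq> 0 \<and> snd q \<noteq> 0"
  shows "val E e (PMul l) \<noteq> 0"
proof -
  have "sgv (val E e (PMul l)) \<noteq> 0"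
    using assms by (simp add: val_PMul(1) prod_list_zero_iff image_iff)
  then show ?thesis by simp
qed

end

section \<open>Generic interpretations\<close>

text \<open>\<open>independent\<close> concerns the image set and does not see repeated values;
  injectivity makes the notion an indexed one.\<close>

definition indep_family :: "('a \<Rightarrow> 'v::real_vector) \<Rightarrow> 'a set \<Rightarrow> bool" where
  "indep_family f T \<longleftrightarrow> inj_on f T \<and> independent (f ` T)"

lemma indep_familyD:
  assumes "indep_family f T" "finite T" "(\<Sum>u\<in>T. c u *\<^sub>R f u) = 0" "u \<in> T"
  shows "c u = 0"
proof -
  have inj: "inj_on f T" using assms(1) by (simp add: indep_family_def)
  have "(\<Sum>v\<in>f ` T. c (inv_into T f v) *\<^sub>R v) = 0"
    using assms(3) inj by (simp add: sum.reindex)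
  then have "c (inv_into T f (f u)) = 0"
    using assms(1,2,4) by (intro independentD[of "f ` T" "f ` T"]) (auto simp: indep_family_def)
  then show ?thesis using inj assms(4) by simp
qed

lemma indep_family_insert:
  "indep_family f T \<Longrightarrow> f x \<notin> span (f ` T) \<Longrightarrow> indep_family f (insert x T)"
  using span_base[of "f x" "f ` T"] by (auto simp: indep_family_def inj_on_insert independent_insertI)

lemma indep_family_cong:
  assumes "\<And>x. x \<in> T \<Longrightarrow> f x = g x"
  shows "indep_family f T = indep_family g T"
  using assms inj_on_cong[of T f g] image_cong[of T T f g] by (auto simp: indep_family_def)

definition closed_under_comps :: "pt set \<Rightarrow> bool" where
  "closed_under_comps S \<longleftrightarrow> (\<forall>p\<in>S. acomps p \<subseteq> S \<and> mcomps p \<subseteq> S)"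

text \<open>The logarithm of 1 is 0 and would spoil independence. With \<open>log_unit\<close> in
  its place, the remaining logarithms are independent even modulo real factors of the
  values.\<close>

definition log_val :: "(logvec \<Rightarrow> vec) \<Rightarrow> (nat \<Rightarrow> vec) \<Rightarrow> pt \<Rightarrow> logvec" where
  "log_val E e p = (if p = POne then log_unit else lam E (val E e p))"

text \<open>Sums occur only in the second family and products only in the first, each where some
  freedom is left: the value of a sum and the logarithm of a product are forced by their components.
  Variables and 1 occur in both.\<close>

definition generic :: "real set \<Rightarrow> pt set \<Rightarrow> (logvec \<Rightarrow> vec) \<Rightarrow> (nat \<Rightarrow> vec) \<Rightarrow> bool" where
  "generic F S E e \<longleftrightarrow> gen_exp E \<and> indep_family (val E e) (S \<inter> nonadd F) \<and>
     indep_family (log_val E e) (S \<inter> nonmul F)"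

text \<open>Subtracting the two expansions gives a linear relation, so by independence the
  coefficients are proportional. The conditions concern only the components, so that the lemma also
  applies to a sum about to be added to \<open>S\<close>.\<close>

lemma val_collinear:
  assumes gen: "indep_family (val E e) (S \<inter> nonadd F)" and fin: "finite S"
    and p: "nf F p" "acomps p \<subseteq> S" and w: "nf F w" "acomps w \<subseteq> S"
    and eq: "val E e p = r *\<^sub>R val E e w"
  shows "p = w \<and> r = 1"
proof (rule nf_eqI_acoef[OF strict_order_on_subset[OF strict_order_on_nonadd[of F], of "S \<inter> nonadd F"] p(1) w(1)])
  show sub: "acomps p \<subseteq> S \<inter> nonadd F" "acomps w \<subseteq> S \<inter> nonadd F"
    using p w acomps_subset by blast+
  have "(\<Sum>u\<in>S \<inter> nonadd F. (acoef p u - r * acoef w u) *\<^sub>R val E e u) = val E e p - r *\<^sub>R val E e w"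
    using fin val_acoef[of "S \<inter> nonadd F" _ E e] sub
    by (simp add: scaleR_diff_left sum_subtractf scaleR_sum_right)
  then have "(\<Sum>u\<in>S \<inter> nonadd F. (acoef p u - r * acoef w u) *\<^sub>R val E e u) = 0"
    using eq by simp
  from indep_familyD[OF gen _ this] fin
  show "acoef p u = r * acoef w u" if "u \<in> S \<inter> nonadd F" for u
    using that by simp
qed simp

text \<open>A zero value would be collinear to itself with factor 0 instead of 1.\<close>

lemma val_nonzero:
  assumes "indep_family (val E e) (S \<inter> nonadd F)" "finite S" "nf F p" "acomps p \<subseteq> S"
  shows "val E e p \<noteq> 0"
  using val_collinear[OF assms assms(3,4), of 0] by auto

text \<open>Taking logarithms turns collinearity into a linear relation in which
  \<open>log_unit\<close> has coefficient \<open>ln \<bar>r\<bar>\<close>; independence then equates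
  the exponents.\<close>

lemma log_val_collinear:
  assumes E: "gen_exp E" and gen: "indep_family (log_val E e) (S \<inter> nonmul F)" and fin: "finite S"
    and S: "POne \<in> S" "\<forall>u\<in>S. val E e u \<noteq> 0"
    and p: "nf F p" "mcomps p \<subseteq> S" and w: "nf F w" "mcomps w \<subseteq> S"
    and eq: "val E e w = r *\<^sub>R val E e p" "val E e w \<noteq> 0"
  shows "p = w"
proof (rule nf_eqI_mexp[OF strict_order_on_subset[OF strict_order_on_nonmul[of F], of "S \<inter> nonmul F - {POne}"] p(1) w(1)])
  let ?T = "S \<inter> nonmul F - {POne}"
  show sub: "mcomps p \<subseteq> ?T" "mcomps w \<subseteq> ?T"
    using p w mcomps_subset by blast+
  have lams: "lam E (val E e q) = (\<Sum>u\<in>?T. real_of_int (mexp q u) *\<^sub>R lam E (val E e u))"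
    if "q = p \<or> q = w" for q
    using that p(1) w(1) sub S(2) fin by (intro lam_val_mexp[OF E]) auto
  define c where "c = (\<lambda>u. if u = POne then ln \<bar>r\<bar> else real_of_int (mexp p u - mexp w u))"
  have "r \<noteq> 0" "val E e p \<noteq> 0" using eq by auto
  then have "lam E (val E e w) = ln \<bar>r\<bar> *\<^sub>R log_unit + lam E (val E e p)"
    using lam_scaleR[OF E] eq(1) by simp
  moreover have "(\<Sum>u\<in>?T. c u *\<^sub>R log_val E e u) = lam E (val E e p) - lam E (val E e w)"
    by (simp add: lams sum_subtractf[symmetric] c_def log_val_def scaleR_diff_left)
  moreover have "(\<Sum>u\<in>S \<inter> nonmul F. c u *\<^sub>R log_val E e u) =
      c POne *\<^sub>R log_val E e POne + (\<Sum>u\<in>?T. c u *\<^sub>R log_val E e u)"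
    using fin S(1) by (intro sum.remove) (auto simp: nonmul_def)
  moreover have "c POne *\<^sub>R log_val E e POne = ln \<bar>r\<bar> *\<^sub>R log_unit"
    by (simp add: c_def log_val_def)
  ultimately have "(\<Sum>u\<in>S \<inter> nonmul F. c u *\<^sub>R log_val E e u) = 0" by simp
  then have "c u = 0" if "u \<in> ?T" for u
    using indep_familyD[OF gen] fin that by blast
  then show "mexp p u = mexp w u" if "u \<in> ?T" for u
    using that by (auto simp: c_def)
qed blast

text \<open>Sums do not involve the exponential. A product is determined by the signs and logarithms
  of its factors and by the exponential at its own logarithm, and \<open>E'\<close> has the old
  logarithms at all values that occur.\<close>

lemma val_cong:
  assumes E: "gen_exp E" "gen_exp E'" and S: "closed_under_comps S" "\<forall>w\<in>S. nf F w"
    and nz: "\<forall>w\<in>S. val E e w \<noteq> 0" and lam: "\<forall>w\<in>S. lam E' (val E e w) = lam E (val E e w)"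
    and env: "\<And>i. PVar i \<in> S \<Longrightarrow> e' i = e i" and "w \<in> S"
  shows "val E' e' w = val E e w"
  using \<open>w \<in> S\<close>
proof (induction "rank w" arbitrary: w rule: less_induct)
  case less
  show ?case
  proof (cases w)
    case (PAdd l)
    have "val E' e' (snd q) = val E e (snd q)" if "q \<in> set l" for q
    proof (rule less.hyps)
      show "rank (snd q) < rank w" using rank_component_less(1)[OF that] PAdd by simp
      show "snd q \<in> S"
        using S(1) less.prems that by (force simp: closed_under_comps_def acomps_def PAdd)
    qed
    then show ?thesis by (simp add: PAdd val_PAdd cong: map_cong)
  next
    case (PMul l)
    have S': "fst q \<in> S" "snd q \<noteq> 0" if "q \<in> set l" for q
      using S less.prems that by (force simp: closed_under_comps_def mcomps_def PMul)+
    have vals: "val E' e' (fst q) = val E e (fst q)" if "q \<in> set l" for q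
      using rank_component_less(2)[OF that] PMul S'[OF that] by (intro less.hyps) simp_all
    have nz1: "\<forall>q\<in>set l. val E e (fst q) \<noteq> 0 \<and> snd q \<noteq> 0"
      using S' nz by blast
    then have nz2: "\<forall>q\<in>set l. val E' e' (fst q) \<noteq> 0 \<and> snd q \<noteq> 0"
      using vals by simp
    have "sgv (val E' e' w) = sgv (val E e w)"
      unfolding PMul val_PMul(1)[OF E(1) nz1] val_PMul(1)[OF E(2) nz2]
      using vals by (simp cong: map_cong)
    moreover have "lam E' (val E' e' w) = lam E (val E e w)"
      unfolding PMul val_PMul(2)[OF E(1) nz1] val_PMul(2)[OF E(2) nz2]
      using vals lam S' by (simp cong: map_cong)
    ultimately have "sgv (val E' e' w) *\<^sub>R E' (lam E' (val E' e' w))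
        = sgv (val E e w) *\<^sub>R E' (lam E' (val E e w))"
      using lam less.prems by simp
    then show ?thesis by (simp only: sgv_E_lam[OF E(2)])
  qed (use env less.prems E in \<open>auto simp: E_0\<close>)
qed

lemma rank_comps: "u \<in> acomps q \<union> mcomps q \<Longrightarrow> u = q \<or> rank u < rank q"
  using rank_component_less by (cases q) (fastforce simp: acomps_def mcomps_def)+

lemma generic_nonzero:
  assumes "generic F S E e" "finite S" "closed_under_comps S" "\<forall>w\<in>S. nf F w"
  shows "\<forall>w\<in>S. val E e w \<noteq> 0"
  using assms val_nonzero[of E e S F] by (auto simp: generic_def closed_under_comps_def)

text \<open>For a new sum or variable: its value is given, and no old value depends on its
  logarithm. The value has to avoid the lines through old values, because one logarithm fixes those
  of all nonzero real multiples.\<close>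

lemma generic_step_log:
  assumes gen: "generic F S E e" and fin: "finite S" and one: "POne \<in> S"
    and S: "closed_under_comps S" "\<forall>w\<in>S. nf F w"
    and env: "\<And>i. PVar i \<in> S \<Longrightarrow> e' i = e i" and p: "p \<in> nonmul F" "p \<notin> S" "acomps p \<subseteq> insert p S"
    and c: "val E e' p \<noteq> 0" "\<And>w r. w \<in> S \<Longrightarrow> val E e w \<noteq> r *\<^sub>R val E e' p"
  shows "\<exists>E'. gen_exp E' \<and> indep_family (log_val E' e') (insert p S \<inter> nonmul F) \<and>
    (\<forall>w\<in>insert p S. val E' e' w = val E e' w) \<and> (\<forall>w\<in>S. val E e' w = val E e w)"
proof -
  have E: "gen_exp E" using gen by (simp add: generic_def)
  have nz: "\<forall>w\<in>S. val E e w \<noteq> 0" by (rule generic_nonzero[OF gen fin S])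
  have "one_vec \<in> val E e ` S" using one E_0[OF E] by (intro image_eqI[of _ _ POne]) auto
  moreover have "0 \<notin> val E e ` S" using nz by auto
  ultimately have "\<exists>E'. gen_exp E' \<and> (\<forall>x\<in>val E e ` S. lam E' x = lam E x) \<and>
    lam E' (val E e' p) \<notin> span (log_val E e ` (S \<inter> nonmul F))"
    using fin c by (intro perturb_log[OF E]) auto
  then obtain E' where E': "gen_exp E'" "\<forall>x\<in>val E e ` S. lam E' x = lam E x"
    "lam E' (val E e' p) \<notin> span (log_val E e ` (S \<inter> nonmul F))" by blast
  have vals: "val E' e' w = val E e w" if "w \<in> S" for w
    using val_cong[OF E E'(1) S nz _ env that] E'(2) by blast
  have vals0: "val E e' w = val E e w" if "w \<in> S" for w
    using val_cong[OF E E S nz _ env that] by blast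
  have val_p: "val E' e' p = val E e' p"
  proof (cases p)
    case (PAdd l)
    have "snd q \<in> S" if "q \<in> set l" for q
      using p(3) that rank_component_less(1)[OF that] by (auto simp: PAdd acomps_def)
    then show ?thesis using vals vals0 by (simp add: PAdd val_PAdd cong: map_cong)
  next
    case POne
    then show ?thesis using p(2) one by simp
  next
    case (PMul l)
    then show ?thesis using p(1) by (simp add: nonmul_def)
  qed simp
  have logs: "log_val E' e' w = log_val E e w" if "w \<in> S" for w
    using vals[OF that] E'(2) that by (simp add: log_val_def)
  have "indep_family (log_val E' e') (S \<inter> nonmul F)"
    using gen indep_family_cong[of "S \<inter> nonmul F" "log_val E' e'" "log_val E e"] logs
    by (simp add: generic_def)
  moreover have "log_val E' e' p = lam E' (val E e' p)" using p(2) one val_p by (auto simp: log_val_def)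
  moreover have "log_val E' e' ` (S \<inter> nonmul F) = log_val E e ` (S \<inter> nonmul F)"
    using logs by (intro image_cong) auto
  ultimately have "indep_family (log_val E' e') (insert p (S \<inter> nonmul F))"
    using E'(3) by (intro indep_family_insert) auto
  then have "indep_family (log_val E' e') (insert p S \<inter> nonmul F)" using p(1) by simp
  then show ?thesis using E'(1) vals vals0 val_p by (intro exI[of _ E']) auto
qed

text \<open>The logarithm of a product is forced by its factors, but the exponential at this
  logarithm is still free as long as no old value lies on the same line.\<close>

lemma generic_step_PMul:
  assumes gen: "generic F S E e" and fin: "finite S" and one: "POne \<in> S"
    and S: "closed_under_comps S" "\<forall>w\<in>S. nf F w"
    and p: "nf F (PMul l)" "PMul l \<notin> S" "mcomps (PMul l) \<subseteq> S"
  shows "\<exists>E'. generic F (insert (PMul l) S) E' e"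
proof -
  let ?p = "PMul l"
  have E: "gen_exp E" and A: "indep_family (val E e) (S \<inter> nonadd F)"
    and B: "indep_family (log_val E e) (S \<inter> nonmul F)"
    using gen by (simp_all add: generic_def)
  have nz: "\<forall>w\<in>S. val E e w \<noteq> 0" by (rule generic_nonzero[OF gen fin S])
  have l: "\<forall>q\<in>set l. val E e (fst q) \<noteq> 0 \<and> snd q \<noteq> 0"
    using p(1,3) nz by (auto simp: mcomps_def)
  have p_nz: "val E e ?p \<noteq> 0" by (rule val_PMul_nonzero[OF E l])
  define l0 where "l0 = lam E (val E e ?p)"
  \<comment> \<open>An old value on that line would, by independence of the logarithms, belong to
    the same normal form.\<close>
  have "val E e w \<noteq> r *\<^sub>R E l0" if w: "w \<in> S" for w r
  proof
    assume "val E e w = r *\<^sub>R E l0"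
    then have "val E e w = (r * sgv (val E e ?p)) *\<^sub>R val E e ?p"
      by (simp add: l0_def E_lam[OF E p_nz] absv_sgv)
    then have "?p = w"
      using log_val_collinear[OF E B fin one nz p(1,3)] S w nz by (auto simp: closed_under_comps_def)
    then show False using p(2) w by simp
  qed
  moreover have "one_vec \<in> val E e ` S" using one E_0[OF E] by (intro image_eqI[of _ _ POne]) auto
  moreover have "0 \<notin> val E e ` S" using nz by auto
  ultimately have "\<exists>E'. gen_exp E' \<and> (\<forall>x\<in>val E e ` S. lam E' x = lam E x) \<and>
    E' l0 \<notin> span (val E e ` (S \<inter> nonadd F))"
    using fin by (intro perturb_exp[OF E]) auto
  then obtain E' where E': "gen_exp E'" "\<forall>x\<in>val E e ` S. lam E' x = lam E x"
    "E' l0 \<notin> span (val E e ` (S \<inter> nonadd F))" by blast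
  have vals: "val E' e w = val E e w" if "w \<in> S" for w
    using val_cong[OF E E'(1) S nz _ _ that] E'(2) by blast
  have logs: "log_val E' e w = log_val E e w" if "w \<in> S" for w
    using vals[OF that] E'(2) that by (simp add: log_val_def)
  have comps: "fst q \<in> S" if "q \<in> set l" for q
    using p(3) that by (auto simp: mcomps_def)
  have l': "\<forall>q\<in>set l. val E' e (fst q) \<noteq> 0 \<and> snd q \<noteq> 0"
    using l comps vals by simp
  \<comment> \<open>The factors keep their values and logarithms, so the product keeps its logarithm
    and its new value is \<open>E' l0\<close> up to sign.\<close>
  have "lam E' (val E' e ?p) = l0"
    unfolding l0_def val_PMul(2)[OF E l] val_PMul(2)[OF E'(1) l']
    using comps vals E'(2) by (simp cong: map_cong)
  then have "E' l0 = sgv (val E' e ?p) *\<^sub>R val E' e ?p"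
    using E_lam[OF E'(1) val_PMul_nonzero[OF E'(1) l']] by (simp add: absv_sgv)
  then have "val E' e ?p \<notin> span (val E e ` (S \<inter> nonadd F))"
    using E'(3) span_scale by metis
  moreover have "val E' e ` (S \<inter> nonadd F) = val E e ` (S \<inter> nonadd F)"
    using vals by (intro image_cong) auto
  moreover have "indep_family (val E' e) (S \<inter> nonadd F)"
    using A indep_family_cong[of "S \<inter> nonadd F" "val E' e" "val E e"] vals by simp
  ultimately have "indep_family (val E' e) (insert ?p (S \<inter> nonadd F))"
    by (intro indep_family_insert) auto
  moreover have "insert ?p S \<inter> nonadd F = insert ?p (S \<inter> nonadd F)"
    using p(1) by (auto simp: nonadd_def)
  moreover have "insert ?p S \<inter> nonmul F = S \<inter> nonmul F"
    by (auto simp: nonmul_def)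
  moreover have "indep_family (log_val E' e) (S \<inter> nonmul F)"
    using B indep_family_cong[of "S \<inter> nonmul F" "log_val E' e" "log_val E e"] logs by simp
  ultimately show ?thesis using E'(1) by (auto simp: generic_def)
qed

text \<open>A variable enters both families, so its value is chosen outside the old span before its
  logarithm is made independent. A sum enters only the second family, and
  \<open>val_collinear\<close> keeps its value off all old lines.\<close>

lemma generic_step_nonmul:
  assumes gen: "generic F S E e" and fin: "finite S" and one: "POne \<in> S"
    and S: "closed_under_comps S" "\<forall>w\<in>S. nf F w"
    and p: "p \<in> nonmul F" "p \<notin> S" "acomps p \<subseteq> insert p S"
  shows "\<exists>E' e'. generic F (insert p S) E' e'"
proof (cases p)
  case (PVar i)
  have nz: "\<forall>w\<in>S. val E e w \<noteq> 0" by (rule generic_nonzero[OF gen fin S])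
  obtain y where y: "0 < y" "y \<notin> span (val E e ` S)"
    using exists_pos_not_in_span fin by blast
  define e' where "e' = e(i := y)"
  have env: "e' j = e j" if "PVar j \<in> S" for j using that p(2) by (auto simp: PVar e'_def)
  have val_p: "val E e' p = y" by (simp add: PVar e'_def)
  have "val E e w \<noteq> r *\<^sub>R val E e' p" if "w \<in> S" for w r
  proof
    assume eq: "val E e w = r *\<^sub>R val E e' p"
    then have "r \<noteq> 0" using nz that by auto
    then have "y = (1 / r) *\<^sub>R val E e w" using eq val_p by simp
    then have "y \<in> span (val E e ` S)" using that by (auto intro: span_scale span_base)
    then show False using y(2) by simp
  qed
  then obtain E' where E': "gen_exp E'" "indep_family (log_val E' e') (insert p S \<inter> nonmul F)"
    "\<forall>w\<in>insert p S. val E' e' w = val E e' w" "\<forall>w\<in>S. val E e' w = val E e w"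
    using generic_step_log[OF gen fin one S env p] val_p y(1) by (metis less_irrefl)
  have vals: "val E' e' w = val E e w" if "w \<in> S" for w
    using E'(3,4) that by simp
  have "val E' e' p = y" using E'(3) val_p by simp
  moreover have "span (val E' e' ` (S \<inter> nonadd F)) \<subseteq> span (val E e ` S)"
    using vals by (intro span_mono) auto
  moreover have "indep_family (val E' e') (S \<inter> nonadd F)"
    using gen indep_family_cong[of "S \<inter> nonadd F" "val E' e'" "val E e"] vals
    by (simp add: generic_def)
  ultimately have "indep_family (val E' e') (insert p (S \<inter> nonadd F))"
    using y(2) by (intro indep_family_insert) auto
  moreover have "insert p S \<inter> nonadd F = insert p (S \<inter> nonadd F)"
    by (auto simp: nonadd_def PVar)
  ultimately show ?thesis using E'(1,2) by (auto simp: generic_def)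
next
  case (PAdd l)
  have A: "indep_family (val E e) (S \<inter> nonadd F)" using gen by (simp add: generic_def)
  have nf: "nf F p" using p(1) by (simp add: nonmul_def)
  have comps: "acomps p \<subseteq> S"
    using p(3) rank_component_less(1)[of _ l] by (fastforce simp: PAdd acomps_def)
  have "val E e w \<noteq> r *\<^sub>R val E e p" if w: "w \<in> S" for w r
  proof
    assume "val E e w = r *\<^sub>R val E e p"
    moreover have "nf F w" "acomps w \<subseteq> S" using S w by (auto simp: closed_under_comps_def)
    ultimately have "w = p" using val_collinear[OF A fin _ _ nf comps] by blast
    then show False using w p(2) by simp
  qed
  then obtain E' where E': "gen_exp E'" "indep_family (log_val E' e) (insert p S \<inter> nonmul F)"
    "\<forall>w\<in>insert p S. val E' e w = val E e w"
    using generic_step_log[OF gen fin one S _ p, of e] val_nonzero[OF A fin nf comps] by metis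
  have "insert p S \<inter> nonadd F = S \<inter> nonadd F" by (auto simp: nonadd_def PAdd)
  moreover have "indep_family (val E' e) (S \<inter> nonadd F)"
    using A indep_family_cong[of "S \<inter> nonadd F" "val E' e" "val E e"] E'(3) by simp
  ultimately show ?thesis using E'(1,2) by (auto simp: generic_def)
next
  case POne
  then show ?thesis using p(2) one by simp
next
  case (PMul l)
  then show ?thesis using p(1) by (simp add: nonmul_def)
qed

lemma generic_POne: "generic F {POne} vec_exp e"
proof -
  have "val vec_exp e POne \<noteq> 0"
    using E_pos[OF exp_like_vec_exp, of 0] by simp
  moreover have "log_val vec_exp e POne \<noteq> 0" by (simp add: log_val_def log_unit_def zero_prod_def)
  moreover have "{POne} \<inter> nonadd F = {POne}" "{POne} \<inter> nonmul F = {POne}"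
    by (auto simp: nonadd_def nonmul_def)
  ultimately show ?thesis
    using exp_like_vec_exp by (simp add: generic_def indep_family_def)
qed

text \<open>A preterm of maximal rank among those other than 1 is no component of the rest, so
  removing it leaves a closed set and it can be added last.\<close>

lemma exists_generic:
  assumes "finite S" "POne \<in> S" "closed_under_comps S" "\<forall>w\<in>S. nf F w"
  shows "\<exists>E e. generic F S E e"
  using assms
proof (induction "card S" arbitrary: S rule: less_induct)
  case less
  show ?case
  proof (cases "S = {POne}")
    case True
    then show ?thesis using generic_POne by blast
  next
    case False
    define X where "X = S - {POne}"
    have "finite X" "X \<noteq> {}" using False less.prems by (auto simp: X_def)
    then have "Max (rank ` X) \<in> rank ` X" "\<forall>q\<in>X. rank q \<le> Max (rank ` X)" by auto
    then obtain p where p: "p \<in> X" "\<forall>q\<in>X. rank q \<le> rank p" by auto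
    define S' where "S' = S - {p}"
    have S: "S = insert p S'" "p \<notin> S'" "finite S'" "POne \<in> S'" "\<forall>w\<in>S'. nf F w" "nf F p"
      using p(1) less.prems by (auto simp: S'_def X_def)
    have "u \<in> S'" if "q \<in> S'" "u \<in> acomps q \<union> mcomps q" for q u
    proof -
      have "u \<in> S" using less.prems(3) that S(1) by (auto simp: closed_under_comps_def)
      moreover have "u \<noteq> p"
      proof
        assume "u = p"
        then have "rank p < rank q" using rank_comps[OF that(2)] that(1) S(2) by blast
        moreover have "rank q \<le> rank p"
          using p(2) that(1) by (cases "q = POne") (auto simp: X_def S'_def)
        ultimately show False by simp
      qed
      ultimately show ?thesis by (simp add: S'_def)
    qed
    then have closed: "closed_under_comps S'" by (auto simp: closed_under_comps_def)
    have "card S' < card S" using S(1-3) by simp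
    then obtain E e where gen: "generic F S' E e"
      using less.hyps S(3-5) closed by blast
    have comps: "acomps p \<subseteq> insert p S'" "mcomps p \<subseteq> insert p S'"
      using less.prems(3) S(1) by (auto simp: closed_under_comps_def)
    show ?thesis
    proof (cases "is_mul p")
      case True
      then obtain l where l: "p = PMul l" by (cases p) auto
      have "mcomps p \<subseteq> S'"
        using comps(2) rank_component_less(2)[of _ l] by (fastforce simp: l mcomps_def)
      then have "\<exists>E'. generic F (insert (PMul l) S') E' e"
        using S(2,6) unfolding l by (intro generic_step_PMul[OF gen S(3,4) closed S(5)])
      then show ?thesis using S(1) l by blast
    next
      case False
      then show ?thesis
        using generic_step_nonmul[OF gen S(3,4) closed S(5)] S(1,2,6) comps(1)
        by (auto simp: nonmul_def)
    qed
  qed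
qed

lemma exists_finite_closure: "\<exists>S. finite S \<and> p \<in> S \<and> closed_under_comps S \<and> (nf F p \<longrightarrow> (\<forall>w\<in>S. nf F w))"
proof (induction "rank p" arbitrary: p rule: less_induct)
  case less
  \<comment> \<open>\<open>p\<close> may be its own component and has to be left out for the
    induction on rank.\<close>
  let ?C = "acomps p \<union> mcomps p - {p}"
  have "\<exists>S. finite S \<and> q \<in> S \<and> closed_under_comps S \<and> (nf F q \<longrightarrow> (\<forall>w\<in>S. nf F w))" if "q \<in> ?C" for q
    using that rank_comps[of q p] by (intro less.hyps) auto
  then obtain f where f: "\<And>q. q \<in> ?C \<Longrightarrow> finite (f q) \<and> q \<in> f q \<and> closed_under_comps (f q) \<and>
      (nf F q \<longrightarrow> (\<forall>w\<in>f q. nf F w))" by metis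
  define S where "S = insert p (\<Union>q\<in>?C. f q)"
  have "finite S" using f by (simp add: S_def finite_acomps finite_mcomps)
  moreover have "closed_under_comps S"
    using f unfolding closed_under_comps_def S_def by (auto; blast)
  moreover have "nf F q" if "nf F p" "q \<in> ?C" for q
    using that acomps_subset[OF that(1)] mcomps_subset[OF that(1)] by (auto simp: nonadd_def nonmul_def)
  then have "nf F p \<longrightarrow> (\<forall>w\<in>S. nf F w)" using f by (auto simp: S_def)
  ultimately show ?case by (intro exI[of _ S]) (simp add: S_def)
qed

section \<open>Transport to the real line\<close>

text \<open>Provability quantifies over models with real carrier only. Values of the operations
  outside \<open>range h\<close> are immaterial, as the domain is \<open>range h\<close>.\<close>

definition transport :: "('m \<Rightarrow> 'n) \<Rightarrow> 'm struc \<Rightarrow> 'n struc" where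
  "transport h M = \<lparr>dom = range h, zer = h (zer M), onef = h (onef M),
     addf = (\<lambda>x y. h (addf M (inv h x) (inv h y))), subf = (\<lambda>x y. h (subf M (inv h x) (inv h y))),
     mulf = (\<lambda>x y. h (mulf M (inv h x) (inv h y))), divf = (\<lambda>x y. h (divf M (inv h x) (inv h y))),
     scf = (\<lambda>a x. h (scf M a (inv h x))), lessf = (\<lambda>x y. lessf M (inv h x) (inv h y))\<rparr>"

lemma eval_transport: "inj h \<Longrightarrow> eval (transport h M) (h \<circ> e) t = h (eval M e t)"
  by (induction t) (auto simp: transport_def)

lemma sat_transport:
  assumes "inj h" "dom M = UNIV"
  shows "sat (transport h M) (h \<circ> e) p \<longleftrightarrow> sat M e p"
proof (induction p arbitrary: e)
  case (FEq s t)
  show ?case by (simp only: sat.simps eval_transport[OF assms(1)] inj_eq[OF assms(1)])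
next
  case (FLess s t)
  have "lessf (transport h M) (h x) (h y) = lessf M x y" for x y
    using assms(1) by (simp add: transport_def)
  then show ?case by (simp only: sat.simps eval_transport[OF assms(1)])
next
  case (FEx x p)
  have "sat (transport h M) ((h \<circ> e)(x := h d)) p = sat M (e(x := d)) p" for d
    using FEx.IH[of "e(x := d)"] by (simp only: fun_upd_comp)
  moreover have "dom (transport h M) = range h" by (simp add: transport_def)
  ultimately show ?case unfolding sat.simps assms(2) by auto
qed auto

lemma is_model_transport:
  fixes M :: "'m struc"
  assumes "inj h" "dom M = UNIV" and M: "\<And>p e. p \<in> T_full F \<Longrightarrow> sat M e p"
  shows "is_model F (transport h M)"
  unfolding is_model_def
proof (intro conjI ballI allI impI)
  show "is_struc F (transport h M)" by (auto simp: is_struc_def transport_def)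
  fix p e assume p: "p \<in> T_full F" and "env_in (transport h M) e"
  then have "e = h \<circ> (inv h \<circ> e)"
    by (auto simp: env_in_def transport_def fun_eq_iff f_inv_into_f)
  then show "sat (transport h M) e p" using sat_transport[OF assms(1,2)] M[OF p] by metis
qed

section \<open>Separation of normal forms\<close>

lemma T_proves_eq_exp_struc:
  assumes "T_proves_eq F s t" "gen_exp E"
  shows "eval (exp_struc E) e s = eval (exp_struc E) e t"
proof -
  obtain h :: "vec \<Rightarrow> real" where h: "inj h" using exists_inj_vec_real by blast
  have "sat (exp_struc E) e p" if "p \<in> T_full F" for p e
    using that sat_T_add[OF add_struc_exp_struc[OF assms(2)]] sat_T_mult[OF mult_struc_exp_struc[OF assms(2)]]
    by (auto simp: T_full_def)
  then have "is_model F (transport h (exp_struc E))"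
    by (intro is_model_transport[OF h]) (auto simp: exp_struc_def)
  moreover have "env_in (transport h (exp_struc E)) (h \<circ> e)"
    by (simp add: env_in_def transport_def)
  ultimately have "eval (transport h (exp_struc E)) (h \<circ> e) s = eval (transport h (exp_struc E)) (h \<circ> e) t"
    using assms(1) by (auto simp: T_proves_eq_def)
  then show ?thesis using h by (simp add: eval_transport inj_eq)
qed

text \<open>One generic interpretation serves both preterms, through a common closed set of subterms
  containing 1. Separation is up to real factors because terms carry a leading coefficient.\<close>

lemma val_separates:
  assumes "nf F p" "nf F q"
  shows "\<exists>E e. gen_exp E \<and> val E e p \<noteq> 0 \<and> (\<forall>r. val E e p = r *\<^sub>R val E e q \<longrightarrow> p = q \<and> r = 1)"
proof -
  obtain P where P: "finite P" "p \<in> P" "closed_under_comps P" "\<forall>w\<in>P. nf F w"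
    using exists_finite_closure[of p F] assms(1) by blast
  obtain Q where Q: "finite Q" "q \<in> Q" "closed_under_comps Q" "\<forall>w\<in>Q. nf F w"
    using exists_finite_closure[of q F] assms(2) by blast
  define S where "S = insert POne (P \<union> Q)"
  have S: "finite S" "POne \<in> S" "closed_under_comps S" "\<forall>w\<in>S. nf F w"
  proof -
    have "acomps POne = {POne}" "mcomps POne = {}" by (simp_all add: acomps_def mcomps_def)
    then show "closed_under_comps S"
      using P(3) Q(3) unfolding closed_under_comps_def S_def by blast
  qed (use P Q in \<open>auto simp: S_def\<close>)
  then obtain E e where gen: "generic F S E e" using exists_generic by blast
  have comps: "acomps p \<subseteq> S" "acomps q \<subseteq> S"
    using S(3) P(2) Q(2) by (auto simp: closed_under_comps_def S_def)
  then show ?thesis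
    using gen val_collinear[OF _ S(1) assms(1) comps(1) assms(2) comps(2)]
      val_nonzero[OF _ S(1) assms(1) comps(1)]
    unfolding generic_def by blast
qed

lemma eval_Sc_render: "eval (exp_struc E) e (Sc a (render p)) = a *\<^sub>R val E e p"
  by (simp add: val_def exp_struc_def)

theorem theorem8p3:
  fixes F :: "real set" and s t :: fterm
  assumes "subfield_of_reals F"
    and "nf_term F s" and "nf_term F t"
    and "T_proves_eq F s t"
  shows "s = t"
proof -
  have zero: False
    if eq: "T_proves_eq F Zero u \<or> T_proves_eq F u Zero" and u: "u = Sc a (render p)" "a \<noteq> 0" "nf F p"
    for a p u
  proof -
    obtain E e where E: "gen_exp E" "val E e p \<noteq> 0" using val_separates[OF u(3) u(3)] by blast
    have "eval (exp_struc E) e Zero = 0" by (simp add: exp_struc_def)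
    moreover have "eval (exp_struc E) e Zero = eval (exp_struc E) e u"
      using eq T_proves_eq_exp_struc[OF _ E(1)] by metis
    ultimately have "a *\<^sub>R val E e p = 0" by (simp only: u(1) eval_Sc_render)
    then show False using E(2) u(2) by simp
  qed
  show ?thesis
  proof (cases "s = Zero \<or> t = Zero")
    case True
    then have "s = Zero \<and> t = Zero"
      using zero[of t] zero[of s] assms(2-4) unfolding nf_term_def by metis
    then show ?thesis by simp
  next
    case False
    then obtain a p b q where s: "a \<noteq> 0" "nf F p" "s = Sc a (render p)"
      and t: "b \<noteq> 0" "nf F q" "t = Sc b (render q)"
      using assms(2,3) by (auto simp: nf_term_def)
    obtain E e where E: "gen_exp E" "\<And>r. val E e p = r *\<^sub>R val E e q \<Longrightarrow> p = q \<and> r = 1"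
      using val_separates[OF s(2) t(2)] by blast
    have "a *\<^sub>R val E e p = b *\<^sub>R val E e q"
      using T_proves_eq_exp_struc[OF assms(4) E(1), of e] by (simp only: s(3) t(3) eval_Sc_render)
    \<comment> \<open>Both leading coefficients are absorbed into the single factor
      \<open>b / a\<close>, which separation forces to be 1.\<close>
    then have "(1 / a) *\<^sub>R a *\<^sub>R val E e p = (1 / a) *\<^sub>R b *\<^sub>R val E e q" by simp
    then have "val E e p = (b / a) *\<^sub>R val E e q" using s(1) by simp
    from E(2)[OF this] show ?thesis using s t by simp
  qed
qed

end
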